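(* For $0<p\le 1$ let $X_p$ denote any one of the spaces $H^p$, $D^p_{p-1}$, $HL_p$. Then the following assertions hold: (i) $T(X_1,H^\infty)$ contains all polynomials; (ii) if $0<p<1$, then $T(X_p,H^\infty)$ consists of constant functions only; (iii) $T_c(X_1,H^\infty)$ consists of constant functions only.
   Context: $\mathbb D=\{z\in\mathbb C:|z|<1\}$ and $\mathcal H(\mathbb D)$ is the space of analytic functions in $\mathbb D$. For $f\in\mathcal H(\mathbb D)$, $\widehat f(n)$ denotes the $n$-th Maclaurin coefficient. For $g\in\mathcal H(\mathbb D)$, $T_g(f)(z)=\int_0^z f(\zeta)g'(\zeta)\,d\zeta$, $z\in\mathbb D$. $T(X,H^\infty)$ (resp. $T_c(X,H^\infty)$) denotes the set of $g\in\mathcal H(\mathbb D)$ such that $T_g:X\to H^\infty$ is bounded (resp. compact). $H^p$ ($0<p\le\infty$) is the Hardy space with $\|f\|_{H^p}=\sup_{0<r<1}M_p(r,f)$, where $M_p(r,f)=\left(\frac1{2\pi}\int_0^{2\pi}|f(re^{i\theta})|^p\,d\theta\right)^{1/p}$ for $p<\infty$ and $M_\infty(r,f)=\max_\theta|f(re^{i\theta})|$. $D^p_{p-1}$ is the space of $f\in\mathcal H(\mathbb D)$ with $\|f\|_{D^p_{p-1}}^p=\int_{\mathbb D}|f'(z)|^p(1-|z|)^{p-1}\,dA(z)+|f(0)|^p<\infty$, where $dA=\frac{dx\,dy}{\pi}$. $HL_p$ is the space of $f\in\mathcal H(\mathbb D)$ with $\|f\|_{HL_p}^p=\sum_{n=0}^\infty|\widehat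 f(n)|^p(n+1)^{p-2}<\infty$. For $0<p<1$ these are quasi-normed spaces. *)

theory Defs
  imports
    "HOL-Complex_Analysis.Complex_Analysis"
    "HOL-Computational_Algebra.Polynomial"
begin

text \<open>
  An analytic function in the unit disc is represented by any function on \<open>\<complex>\<close> that is holomorphic
  on the disc; all notions below depend only on its values in the disc. The (quasi-)norms are
  real-valued, so finiteness is part of the definition of each space (as boundedness,
  integrability or summability), and a norm is only meaningful on its space.
\<close>

abbreviation unit_disc :: "complex set"  (\<open>\<bbbD>\<close>)
  where "\<bbbD> \<equiv> ball 0 1"

definition maclaurin_coeff :: "(complex \<Rightarrow> complex) \<Rightarrow> nat \<Rightarrow> complex"
  where "maclaurin_coeff f n = (deriv ^^ n) f 0 / fact n"


subsection \<open>The spaces\<close>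

definition hardy_mean :: "real \<Rightarrow> real \<Rightarrow> (complex \<Rightarrow> complex) \<Rightarrow> real"
  where "hardy_mean p r f =
    (1 / (2 * pi) * integral {0..2 * pi} (\<lambda>\<theta>. cmod (f (of_real r * cis \<theta>)) powr p)) powr (1 / p)"

definition hardy_norm :: "real \<Rightarrow> (complex \<Rightarrow> complex) \<Rightarrow> real"
  where "hardy_norm p f = (SUP r\<in>{0<..<1}. hardy_mean p r f)"

definition hardy_space :: "real \<Rightarrow> (complex \<Rightarrow> complex) set"
  where "hardy_space p =
    {f. f holomorphic_on \<bbbD> \<and> bdd_above ((\<lambda>r. hardy_mean p r f) ` {0<..<1})}"

definition max_modulus :: "real \<Rightarrow> (complex \<Rightarrow> complex) \<Rightarrow> real"
  where "max_modulus r f = (SUP \<theta>\<in>{0..2 * pi}. cmod (f (of_real r * cis \<theta>)))"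

definition Hinf_norm :: "(complex \<Rightarrow> complex) \<Rightarrow> real"
  where "Hinf_norm f = (SUP r\<in>{0<..<1}. max_modulus r f)"

definition Hinf :: "(complex \<Rightarrow> complex) set"
  where "Hinf = {f. f holomorphic_on \<bbbD> \<and> bdd_above ((\<lambda>r. max_modulus r f) ` {0<..<1})}"

text \<open>
  The Dirichlet-type space \<open>D\<^sup>p\<^bsub>p-1\<^esub>\<close>; the factor \<open>1 / pi\<close> normalises the area measure.
\<close>

definition dirichlet_norm :: "real \<Rightarrow> (complex \<Rightarrow> complex) \<Rightarrow> real"
  where "dirichlet_norm p f =
    (1 / pi * (LINT z:\<bbbD>|lborel. cmod (deriv f z) powr p * (1 - cmod z) powr (p - 1))
      + cmod (f 0) powr p) powr (1 / p)"

definition dirichlet_space :: "real \<Rightarrow> (complex \<Rightarrow> complex) set"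
  where "dirichlet_space p =
    {f. f holomorphic_on \<bbbD> \<and>
        set_integrable lborel \<bbbD> (\<lambda>z. cmod (deriv f z) powr p * (1 - cmod z) powr (p - 1))}"

definition HL_norm :: "real \<Rightarrow> (complex \<Rightarrow> complex) \<Rightarrow> real"
  where "HL_norm p f =
    (\<Sum>n. cmod (maclaurin_coeff f n) powr p * real (n + 1) powr (p - 2)) powr (1 / p)"

definition HL_space :: "real \<Rightarrow> (complex \<Rightarrow> complex) set"
  where "HL_space p =
    {f. f holomorphic_on \<bbbD> \<and>
        summable (\<lambda>n. cmod (maclaurin_coeff f n) powr p * real (n + 1) powr (p - 2))}"


subsection \<open>The integral operator and its symbol classes\<close>

definition T_op :: "(complex \<Rightarrow> complex) \<Rightarrow> (complex \<Rightarrow> complex) \<Rightarrow> complex \<Rightarrow> complex"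
  where "T_op g f z = contour_integral (linepath 0 z) (\<lambda>\<zeta>. f \<zeta> * deriv g \<zeta>)"

text \<open>
  In the next two definitions \<open>X\<close> is a function space and \<open>N\<close> its quasi-norm. Compactness means that
  the image of every \<open>N\<close>-bounded sequence has a subsequence converging in the norm of \<open>H\<^sup>\<infinity>\<close>.
\<close>

definition T_bounded ::
    "(complex \<Rightarrow> complex) set \<Rightarrow> ((complex \<Rightarrow> complex) \<Rightarrow> real) \<Rightarrow> (complex \<Rightarrow> complex) set"
  where "T_bounded X N =
    {g. g holomorphic_on \<bbbD> \<and> (\<forall>f\<in>X. T_op g f \<in> Hinf) \<and>
        (\<exists>C. \<forall>f\<in>X. Hinf_norm (T_op g f) \<le> C * N f)}"

definition T_compact ::
    "(complex \<Rightarrow> complex) set \<Rightarrow> ((complex \<Rightarrow> complex) \<Rightarrow> real) \<Rightarrow> (complex \<Rightarrow> complex) set"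
  where "T_compact X N =
    {g. g holomorphic_on \<bbbD> \<and> (\<forall>f\<in>X. T_op g f \<in> Hinf) \<and>
        (\<forall>F :: nat \<Rightarrow> complex \<Rightarrow> complex. (\<forall>n. F n \<in> X) \<and> (\<exists>C. \<forall>n. N (F n) \<le> C) \<longrightarrow>
          (\<exists>k :: nat \<Rightarrow> nat. \<exists>h\<in>Hinf. strict_mono k \<and>
            (\<lambda>n. Hinf_norm (\<lambda>z. T_op g (F (k n)) z - h z)) \<longlonglongrightarrow> 0))}"

definition const_on_disc :: "(complex \<Rightarrow> complex) set"
  where "const_on_disc = {g. \<exists>c. \<forall>z\<in>\<bbbD>. g z = c}"

end

theory Submission imports Defs begin

text \<open>
  A test function \<open>F\<^sub>a(z) = (1 - \<bar>a\<bar>)^(k - 1/p) / (1 - cnj a * z)^k\<close> with \<open>kp \<ge> 2\<close> has norm bounded independently of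
  \<open>a\<close> in each of the three spaces. Cauchy's estimate for the derivative \<open>F\<^sub>a g'\<close> of \<open>T\<^sub>g F\<^sub>a\<close> at the point \<open>a\<close> turns
  boundedness of \<open>T\<^sub>g\<close> into \<open>\<bar>g'(a)\<bar> \<le> C (1 - \<bar>a\<bar>)^(1/p - 1)\<close>. For \<open>p < 1\<close> the right-hand side vanishes at the
  boundary, so \<open>g' = 0\<close> by the maximum principle. For \<open>p = 1\<close> and compact \<open>T\<^sub>g\<close>, the functions \<open>F\<^sub>a\<close> tend to \<open>0\<close>
  pointwise as \<open>\<bar>a\<bar> \<rightarrow> 1\<close>, so the norm of \<open>T\<^sub>g F\<^sub>a\<close> tends to \<open>0\<close> along a subsequence and again \<open>g' = 0\<close>.
  Conversely, the primitive of a function in \<open>H\<^sup>1\<close> is bounded, because its oscillation on a circle is at most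
  the integral of the modulus of the function over that circle; in the other two spaces the bound follows from \<open>D\<^sup>1\<^sub>0 \<subseteq> H\<^sup>1\<close>
  and from the absolute convergence of \<open>\<Sum> a\<^sub>n / (n + 1)\<close>, respectively.
\<close>

subsection \<open>Polar coordinates\<close>

text \<open>Lebesgue measure is determined by its values on boxes, and the preimage of a complex box
  is a real box with the same sides. This opens integrals over \<open>complex\<close> to Tonelli's
  theorem.\<close>

lemma distr_Complex_lborel:
  "distr (lborel :: (real \<times> real) measure) borel (\<lambda>(x, y). Complex x y) = lborel"
proof (rule lborel_eqI[symmetric])
  have [measurable]: "(\<lambda>(x, y). Complex x y) \<in> borel_measurable (borel :: (real \<times> real) measure)"
    by (intro borel_measurable_continuous_onI) (simp add: case_prod_unfold Complex_eq continuous_intros)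
  fix l u :: complex
  assume le: "\<And>b. b \<in> Basis \<Longrightarrow> l \<bullet> b \<le> u \<bullet> b"
  have "(\<lambda>(x, y). Complex x y) -` box l u = box (Re l, Im l) (Re u, Im u)"
    by (auto simp: box_def Basis_complex_def Basis_prod_def inner_complex_def)
  then show "emeasure (distr (lborel :: (real \<times> real) measure) borel (\<lambda>(x, y). Complex x y)) (box l u)
      = (\<Prod>b\<in>Basis. (u - l) \<bullet> b)"
    using le[of 1] le[of \<i>]
    by (subst emeasure_distr)
      (auto simp: Basis_complex_def emeasure_lborel_box_eq Basis_prod_def inner_complex_def)
qed simp

lemma nn_integral_complex_eq:
  assumes [measurable]: "f \<in> borel_measurable borel"
  shows "(\<integral>\<^sup>+z. f z \<partial>lborel) = (\<integral>\<^sup>+x. \<integral>\<^sup>+y. f (Complex x y) \<partial>lborel \<partial>lborel)"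
proof -
  have [measurable]: "(\<lambda>(x, y). Complex x y) \<in> borel_measurable (borel :: (real \<times> real) measure)"
    by (intro borel_measurable_continuous_onI) (simp add: case_prod_unfold Complex_eq continuous_intros)
  have "(\<integral>\<^sup>+z. f z \<partial>lborel) = (\<integral>\<^sup>+z. f (case z of (x, y) \<Rightarrow> Complex x y) \<partial>(lborel :: (real \<times> real) measure))"
    by (subst distr_Complex_lborel[symmetric]) (simp add: nn_integral_distr)
  also have "\<dots> = (\<integral>\<^sup>+z. f (case z of (x, y) \<Rightarrow> Complex x y) \<partial>(lborel \<Otimes>\<^sub>M lborel))"
    by (simp add: lborel_prod)
  also have "\<dots> = (\<integral>\<^sup>+x. \<integral>\<^sup>+y. f (Complex x y) \<partial>lborel \<partial>lborel)"
    by (subst lborel.nn_integral_fst[symmetric]) (simp_all add: lborel_prod)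
  finally show ?thesis .
qed

text \<open>The substitution rule is applied on compact intervals; both sides are exhausted by the
  truncations \<open>a\<close> and \<open>b\<close>, and monotone convergence yields the identity
  for the whole line.\<close>

lemma nn_integral_arctan:
  fixes f :: "real \<Rightarrow> ennreal"
  assumes [measurable]: "f \<in> borel_measurable borel"
  shows "(\<integral>\<^sup>+s. f (arctan s) * ennreal (1 / (1 + s\<^sup>2)) \<partial>lborel)
    = (\<integral>\<^sup>+\<theta>. f \<theta> * indicator {- (pi / 2) <..< pi / 2} \<theta> \<partial>lborel)"
proof -
  define a b where "a = (\<lambda>n s. f (arctan s) * ennreal (1 / (1 + s\<^sup>2)) * indicator {- real (Suc n)..real (Suc n)} s)"
    and "b = (\<lambda>n \<theta>. f \<theta> * indicator {arctan (- real (Suc n))..arctan (real (Suc n))} \<theta>)"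
  have U1: "(\<Union>n. {- real (Suc n)..real (Suc n)}) = UNIV"
  proof -
    have "\<exists>n. x \<in> {- real (Suc n)..real (Suc n)}" for x
      using reals_Archimedean2[of "\<bar>x\<bar>"] by (auto simp: abs_if split: if_splits intro: exI less_imp_le) (smt (verit) of_nat_Suc)+
    then show ?thesis by blast
  qed
  have U2: "(\<Union>n. {arctan (- real (Suc n))..arctan (real (Suc n))}) = {- (pi / 2) <..< pi / 2}" (is "?U = ?V")
  proof
    show "?U \<subseteq> ?V"
    proof
      fix x assume "x \<in> ?U"
      then obtain n where "arctan (- real (Suc n)) \<le> x" "x \<le> arctan (real (Suc n))"
        by auto
      then show "x \<in> ?V"
        using arctan_lbound[of "- real (Suc n)"] arctan_ubound[of "real (Suc n)"] by auto
    qed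
    show "?V \<subseteq> ?U"
    proof
      fix x assume x: "x \<in> ?V"
      obtain n where n: "tan x \<in> {- real (Suc n)..real (Suc n)}"
        using U1 by blast
      have "arctan (tan x) = x"
        using x by (intro arctan_tan) auto
      then show "x \<in> ?U"
        using n arctan_le_iff[of "- real (Suc n)" "tan x"] arctan_le_iff[of "tan x" "real (Suc n)"] by auto
    qed
  qed
  have eq: "integral\<^sup>N lborel (b n) = integral\<^sup>N lborel (a n)" for n
    unfolding a_def b_def
    by (subst nn_integral_substitution_aux[where g' = "\<lambda>x. 1 / (1 + x\<^sup>2)"])
      (auto intro!: derivative_eq_intros continuous_intros simp: inverse_eq_divide add_nonneg_eq_0_iff)
  have "(\<lambda>n. integral\<^sup>N lborel (a n)) \<longlonglongrightarrow> (\<integral>\<^sup>+s. f (arctan s) * ennreal (1 / (1 + s\<^sup>2)) \<partial>lborel)"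
  proof (rule nn_integral_LIMSEQ)
    show "incseq a"
      unfolding incseq_def le_fun_def a_def by (auto intro!: mult_left_mono simp: indicator_def)
    show "(\<lambda>i. a i x) \<longlonglongrightarrow> f (arctan x) * ennreal (1 / (1 + x\<^sup>2))" for x
    proof -
      have "\<forall>\<^sub>F n in sequentially. indicator {- real (Suc n)..real (Suc n)} x = (1 :: ennreal)"
      proof (rule eventually_sequentiallyI[of "nat \<lceil>\<bar>x\<bar>\<rceil>"])
        fix n assume "nat \<lceil>\<bar>x\<bar>\<rceil> \<le> n"
        then have "\<bar>x\<bar> \<le> real (Suc n)"
          by linarith
        then show "indicator {- real (Suc n)..real (Suc n)} x = (1 :: ennreal)"
          by (auto simp: indicator_def)
      qed
      then show ?thesis
        unfolding a_def by (intro tendsto_eventually) (auto elim!: eventually_mono)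
    qed
  qed (auto simp: a_def)
  moreover have "(\<lambda>n. integral\<^sup>N lborel (b n)) \<longlonglongrightarrow> (\<integral>\<^sup>+\<theta>. f \<theta> * indicator {- (pi / 2) <..< pi / 2} \<theta> \<partial>lborel)"
  proof (rule nn_integral_LIMSEQ)
    have mono: "{arctan (- real (Suc m))..arctan (real (Suc m))} \<subseteq> {arctan (- real (Suc n))..arctan (real (Suc n))}"
      if "m \<le> n" for m n
      using that by (auto simp: arctan_le_iff intro: order_trans)
    show "incseq b"
      unfolding incseq_def le_fun_def b_def
      using mono by (auto intro!: mult_left_mono simp: indicator_def subset_iff)
    show "(\<lambda>i. b i x) \<longlonglongrightarrow> f x * indicator {- (pi / 2) <..< pi / 2} x" for x
    proof (cases "x \<in> {- (pi / 2) <..< pi / 2}")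
      case True
      then obtain N where "x \<in> {arctan (- real (Suc N))..arctan (real (Suc N))}"
        using U2 by blast
      then have "b n x = f x" if "n \<ge> N" for n
        using mono[OF that] unfolding b_def by (auto simp: indicator_def)
      then show ?thesis
        using True by (intro tendsto_eventually eventually_sequentiallyI[of N]) auto
    next
      case False
      then have "b n x = 0" for n
        using U2 unfolding b_def by (auto simp: indicator_def)
      then show ?thesis using False by simp
    qed
  qed (auto simp: b_def)
  ultimately show ?thesis
    unfolding eq by (rule LIMSEQ_unique)
qed

text \<open>Lines through the origin serve as coordinates: the slope \<open>s\<close> gives the
  angle \<open>arctan s\<close> in an open half circle, and the radius is signed. This explains the
  weight \<open>\<bar>r\<bar>\<close> and the angular interval of length \<open>pi\<close>.\<close>

lemma nn_integral_polar_aux: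
  fixes f :: "complex \<Rightarrow> ennreal"
  assumes [measurable]: "f \<in> borel_measurable borel"
  defines "K \<equiv> \<lambda>\<theta>. \<integral>\<^sup>+r. ennreal \<bar>r\<bar> * f (of_real r * cis \<theta>) \<partial>lborel"
  shows "(\<integral>\<^sup>+z. f z \<partial>lborel) = (\<integral>\<^sup>+\<theta>. K \<theta> * indicator {- (pi / 2) <..< pi / 2} \<theta> \<partial>lborel)"
proof -
  have [measurable]: "(\<lambda>(x, y). Complex x y) \<in> borel_measurable (borel \<Otimes>\<^sub>M borel)"
    unfolding borel_prod
    by (intro borel_measurable_continuous_onI) (simp add: case_prod_unfold Complex_eq continuous_intros)
  have [measurable]: "cis \<in> borel_measurable borel"
    by (intro borel_measurable_continuous_onI continuous_intros)
  have [measurable]: "K \<in> borel_measurable borel"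
    unfolding K_def by measurable
  have "(\<integral>\<^sup>+z. f z \<partial>lborel) = (\<integral>\<^sup>+x. \<integral>\<^sup>+y. f (Complex x y) \<partial>lborel \<partial>lborel)"
    by (rule nn_integral_complex_eq) simp
  \<comment> \<open>The substitution \<open>y = x * s\<close> degenerates only at
    \<open>x = 0\<close>, a null set.\<close>
  also have "\<dots> = (\<integral>\<^sup>+x. \<integral>\<^sup>+s. ennreal \<bar>x\<bar> * f (Complex x (x * s)) \<partial>lborel \<partial>lborel)"
  proof (rule nn_integral_cong_AE)
    show "AE x in lborel. (\<integral>\<^sup>+y. f (Complex x y) \<partial>lborel) = (\<integral>\<^sup>+s. ennreal \<bar>x\<bar> * f (Complex x (x * s)) \<partial>lborel)"
      using AE_lborel_singleton[of "0 :: real"]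
    proof eventually_elim
      case (elim x)
      then show ?case
        by (subst nn_integral_real_affine[of _ x 0]) (simp_all add: nn_integral_cmult)
    qed
  qed
  also have "\<dots> = (\<integral>\<^sup>+s. \<integral>\<^sup>+x. ennreal \<bar>x\<bar> * f (Complex x (x * s)) \<partial>lborel \<partial>lborel)"
    by (rule lborel_pair.Fubini'[symmetric]) simp
  also have "\<dots> = (\<integral>\<^sup>+s. K (arctan s) * ennreal (1 / (1 + s\<^sup>2)) \<partial>lborel)"
  proof (rule nn_integral_cong)
    fix s :: real
    \<comment> \<open>\<open>c\<close> is the cosine of \<open>arctan s\<close>. Rescaling
      \<open>x = c * r\<close> turns the abscissa into the signed radius, and \<open>c * c\<close>
      is the derivative of \<open>arctan\<close> at \<open>s\<close>.\<close>
    define c where "c = 1 / sqrt (1 + s\<^sup>2)"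
    have pos: "0 < 1 + s\<^sup>2"
      by (simp add: add_pos_nonneg)
    then have c: "c > 0" "c * c = 1 / (1 + s\<^sup>2)"
      by (simp_all add: c_def)
    have C: "Complex (c * r) (c * r * s) = of_real r * cis (arctan s)" for r
      by (simp add: complex_eq_iff cos_arctan sin_arctan c_def)
    have "(\<integral>\<^sup>+x. ennreal \<bar>x\<bar> * f (Complex x (x * s)) \<partial>lborel)
        = ennreal c * (\<integral>\<^sup>+r. ennreal \<bar>c * r\<bar> * f (Complex (c * r) (c * r * s)) \<partial>lborel)"
      using c by (subst nn_integral_real_affine[of _ c 0]) simp_all
    also have "\<dots> = ennreal c * (\<integral>\<^sup>+r. ennreal c * (ennreal \<bar>r\<bar> * f (of_real r * cis (arctan s))) \<partial>lborel)"
      unfolding C using c by (simp add: abs_mult ennreal_mult mult.assoc)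
    also have "\<dots> = ennreal c * ennreal c * K (arctan s)"
      by (simp add: nn_integral_cmult K_def mult.assoc)
    also have "\<dots> = K (arctan s) * ennreal (1 / (1 + s\<^sup>2))"
      using c by (simp add: ennreal_mult[symmetric] mult.commute)
    finally show "(\<integral>\<^sup>+x. ennreal \<bar>x\<bar> * f (Complex x (x * s)) \<partial>lborel) = K (arctan s) * ennreal (1 / (1 + s\<^sup>2))" .
  qed
  also have "\<dots> = (\<integral>\<^sup>+\<theta>. K \<theta> * indicator {- (pi / 2) <..< pi / 2} \<theta> \<partial>lborel)"
    by (rule nn_integral_arctan) simp
  finally show ?thesis .
qed

text \<open>The signed radius is folded back: the line at angle \<theta> consists of the rays at
  \<theta> and \<open>pi + \<theta>\<close>, so \<open>K\<close> splits into two values of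
  \<open>J\<close>. The factor \<open>ennreal r\<close> vanishes for negative \<open>r\<close>,
  which restricts the outer integral to genuine radii.\<close>

lemma nn_integral_polar:
  fixes f :: "complex \<Rightarrow> ennreal"
  assumes [measurable]: "f \<in> borel_measurable borel"
  shows "(\<integral>\<^sup>+z. f z \<partial>lborel)
    = (\<integral>\<^sup>+r. ennreal r * (\<integral>\<^sup>+\<theta>. f (of_real r * cis \<theta>) * indicator {0..2 * pi} \<theta> \<partial>lborel) \<partial>lborel)"
proof -
  have [measurable]: "cis \<in> borel_measurable borel"
    by (intro borel_measurable_continuous_onI continuous_intros)
  define J where "J = (\<lambda>\<theta>. \<integral>\<^sup>+r. ennreal r * f (of_real r * cis \<theta>) \<partial>lborel)"
  define K where "K = (\<lambda>\<theta>. \<integral>\<^sup>+r. ennreal \<bar>r\<bar> * f (of_real r * cis \<theta>) \<partial>lborel)"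
  have [measurable]: "J \<in> borel_measurable borel" "K \<in> borel_measurable borel"
    unfolding J_def K_def by measurable
  have cis_pi: "cis (\<theta> + pi) = - cis \<theta>" "cis (pi + \<theta>) = - cis \<theta>" for \<theta>
    by (simp_all add: complex_eq_iff cos_add sin_add)
  have KJ: "K \<theta> = J \<theta> + J (pi + \<theta>)" for \<theta>
  proof -
    have "K \<theta> = (\<integral>\<^sup>+r. ennreal r * f (of_real r * cis \<theta>) + ennreal (- r) * f (of_real r * cis \<theta>) \<partial>lborel)"
      unfolding K_def by (intro nn_integral_cong) (auto simp: abs_if ennreal_neg)
    also have "\<dots> = J \<theta> + (\<integral>\<^sup>+r. ennreal (- r) * f (of_real r * cis \<theta>) \<partial>lborel)"
      by (simp add: nn_integral_add J_def)
    also have "(\<integral>\<^sup>+r. ennreal (- r) * f (of_real r * cis \<theta>) \<partial>lborel) = J (pi + \<theta>)"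
      by (subst nn_integral_real_affine[of _ "- 1" 0]) (simp_all add: J_def cis_pi)
    finally show ?thesis .
  qed
  \<comment> \<open>Periodicity moves the part of the half circle below angle 0 to the angles
    between \<open>pi / 2\<close> and \<open>pi\<close>, so that the rays of \<open>J\<close>
    finally fill the angles from 0 to \<open>2 * pi\<close>.\<close>
  have Kpi: "K (pi + \<theta>) = K \<theta>" for \<theta>
    unfolding K_def by (subst nn_integral_real_affine[of _ "- 1" 0]) (simp_all add: cis_pi)
  have "(\<integral>\<^sup>+z. f z \<partial>lborel) = (\<integral>\<^sup>+\<theta>. K \<theta> * indicator {- (pi / 2) <..< pi / 2} \<theta> \<partial>lborel)"
    unfolding K_def by (rule nn_integral_polar_aux) simp
  also have "\<dots> = (\<integral>\<^sup>+\<theta>. K \<theta> * indicator {- (pi / 2) <..< 0} \<theta> + K \<theta> * indicator {0..<pi / 2} \<theta> \<partial>lborel)"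
    using pi_gt_zero by (intro nn_integral_cong) (auto simp: indicator_def)
  also have "\<dots> = (\<integral>\<^sup>+\<theta>. K \<theta> * indicator {- (pi / 2) <..< 0} \<theta> \<partial>lborel) + (\<integral>\<^sup>+\<theta>. K \<theta> * indicator {0..<pi / 2} \<theta> \<partial>lborel)"
    by (simp add: nn_integral_add)
  also have "(\<integral>\<^sup>+\<theta>. K \<theta> * indicator {- (pi / 2) <..< 0} \<theta> \<partial>lborel) = (\<integral>\<^sup>+\<theta>. K \<theta> * indicator {pi / 2 <..< pi} \<theta> \<partial>lborel)"
    by (subst (2) nn_integral_real_affine[of _ 1 pi])
      (auto intro!: nn_integral_cong simp: Kpi indicator_def)
  also have "\<dots> + (\<integral>\<^sup>+\<theta>. K \<theta> * indicator {0..<pi / 2} \<theta> \<partial>lborel)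
      = (\<integral>\<^sup>+\<theta>. K \<theta> * indicator {pi / 2 <..< pi} \<theta> + K \<theta> * indicator {0..<pi / 2} \<theta> \<partial>lborel)"
    by (simp add: nn_integral_add)
  also have "\<dots> = (\<integral>\<^sup>+\<theta>. K \<theta> * indicator {0..<pi} \<theta> \<partial>lborel)"
    using AE_lborel_singleton[of "pi / 2"] pi_gt_zero
    by (intro nn_integral_cong_AE) (auto elim!: eventually_mono simp: indicator_def)
  also have "\<dots> = (\<integral>\<^sup>+\<theta>. J \<theta> * indicator {0..<pi} \<theta> + J (pi + \<theta>) * indicator {0..<pi} \<theta> \<partial>lborel)"
    by (simp add: KJ distrib_right)
  also have "\<dots> = (\<integral>\<^sup>+\<theta>. J \<theta> * indicator {0..<pi} \<theta> \<partial>lborel) + (\<integral>\<^sup>+\<theta>. J (pi + \<theta>) * indicator {0..<pi} \<theta> \<partial>lborel)"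
    by (simp add: nn_integral_add)
  also have "(\<integral>\<^sup>+\<theta>. J (pi + \<theta>) * indicator {0..<pi} \<theta> \<partial>lborel) = (\<integral>\<^sup>+\<theta>. J \<theta> * indicator {pi..<2 * pi} \<theta> \<partial>lborel)"
    by (subst (2) nn_integral_real_affine[of _ 1 pi])
      (auto intro!: nn_integral_cong simp: indicator_def)
  also have "(\<integral>\<^sup>+\<theta>. J \<theta> * indicator {0..<pi} \<theta> \<partial>lborel) + (\<integral>\<^sup>+\<theta>. J \<theta> * indicator {pi..<2 * pi} \<theta> \<partial>lborel)
      = (\<integral>\<^sup>+\<theta>. J \<theta> * indicator {0..<pi} \<theta> + J \<theta> * indicator {pi..<2 * pi} \<theta> \<partial>lborel)"
    by (simp add: nn_integral_add)
  also have "\<dots> = (\<integral>\<^sup>+\<theta>. J \<theta> * indicator {0..2 * pi} \<theta> \<partial>lborel)"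
    using AE_lborel_singleton[of "2 * pi"] pi_gt_zero
    by (intro nn_integral_cong_AE) (auto elim!: eventually_mono simp: indicator_def)
  also have "\<dots> = (\<integral>\<^sup>+\<theta>. \<integral>\<^sup>+r. ennreal r * (f (of_real r * cis \<theta>) * indicator {0..2 * pi} \<theta>) \<partial>lborel \<partial>lborel)"
    by (simp add: J_def nn_integral_multc mult.assoc flip: mult.assoc)
  also have "\<dots> = (\<integral>\<^sup>+r. \<integral>\<^sup>+\<theta>. ennreal r * (f (of_real r * cis \<theta>) * indicator {0..2 * pi} \<theta>) \<partial>lborel \<partial>lborel)"
    by (rule lborel_pair.Fubini'[symmetric]) simp
  also have "\<dots> = (\<integral>\<^sup>+r. ennreal r * (\<integral>\<^sup>+\<theta>. f (of_real r * cis \<theta>) * indicator {0..2 * pi} \<theta> \<partial>lborel) \<partial>lborel)"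
    by (simp add: nn_integral_cmult)
  finally show ?thesis .
qed

subsection \<open>The operator and its test functions\<close>

text \<open>On the convex disc the integrand has a primitive \<open>P\<close>, and integration along
  the segment from 0 gives \<open>P z - P 0\<close>.\<close>

lemma T_op_has_field_derivative:
  assumes f: "f holomorphic_on \<bbbD>" and g: "g holomorphic_on \<bbbD>" and z: "z \<in> \<bbbD>"
  shows "(T_op g f has_field_derivative f z * deriv g z) (at z)"
proof -
  have h: "(\<lambda>\<zeta>. f \<zeta> * deriv g \<zeta>) holomorphic_on \<bbbD>"
    by (intro holomorphic_intros f g) auto
  then obtain P where P: "\<And>x. x \<in> \<bbbD> \<Longrightarrow> (P has_field_derivative f x * deriv g x) (at x within \<bbbD>)"
    using holomorphic_convex_primitive'[OF convex_ball open_ball h] by blast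
  have T: "T_op g f w = P w - P 0" if "w \<in> \<bbbD>" for w
  proof -
    have "closed_segment 0 w \<subseteq> \<bbbD>"
      using that by (intro closed_segment_subset) auto
    then show ?thesis
      unfolding T_op_def using contour_integral_primitive[of "\<bbbD>" P, OF P valid_path_linepath]
      by (simp add: contour_integral_unique)
  qed
  have "((\<lambda>w. P w - P 0) has_field_derivative f z * deriv g z) (at z)"
    using DERIV_diff[OF P[OF z] DERIV_const[of "P 0"]] at_within_open[OF z open_ball] by simp
  then show ?thesis
    by (rule has_field_derivative_transform_within_open[OF _ open_ball z]) (simp add: T)
qed

lemma T_op_holomorphic:
  assumes "f holomorphic_on \<bbbD>" "g holomorphic_on \<bbbD>"
  shows "T_op g f holomorphic_on \<bbbD>"
  unfolding holomorphic_on_open[OF open_ball] using T_op_has_field_derivative[OF assms] by blast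

lemma T_op_0 [simp]: "T_op g f 0 = 0"
  by (simp add: T_op_def)

lemma cmod_T_op_le:
  assumes "f holomorphic_on \<bbbD>" "g holomorphic_on \<bbbD>" "z \<in> \<bbbD>" "0 \<le> B"
    and "\<And>w. cmod w \<le> cmod z \<Longrightarrow> cmod (f w * deriv g w) \<le> B"
  shows "cmod (T_op g f z) \<le> B"
proof -
  have "(T_op g f has_field_derivative f w * deriv g w) (at w within cball 0 (cmod z))"
    if "w \<in> cball 0 (cmod z)" for w
  proof (rule has_field_derivative_at_within, rule T_op_has_field_derivative)
    show "w \<in> \<bbbD>"
      using that assms(3) by simp
  qed fact+
  then have "cmod (T_op g f z - T_op g f 0) \<le> B * cmod (z - 0)"
  proof (rule field_differentiable_bound[OF convex_cball])
    show "cmod (f w * deriv g w) \<le> B" if "w \<in> cball 0 (cmod z)" for w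
      by (rule assms(5)) (use that in simp)
  qed simp_all
  also have "\<dots> \<le> B * 1"
    using assms(3,4) by (intro mult_left_mono) auto
  finally show ?thesis by (simp only: T_op_0 diff_zero mult_1_right)
qed

lemma cmod_of_real_cis [simp]: "cmod (of_real r * cis \<theta>) = \<bar>r\<bar>"
  by (simp add: norm_mult)

section \<open>Pointwise control by the norm of \<open>Hinf\<close>\<close>

lemma
  assumes "f holomorphic_on \<bbbD>" and B: "\<And>z. z \<in> \<bbbD> \<Longrightarrow> cmod (f z) \<le> B"
  shows HinfI: "f \<in> Hinf" and Hinf_norm_le: "Hinf_norm f \<le> B"
proof -
  have m: "max_modulus r f \<le> B" if "r \<in> {0<..<1}" for r
    unfolding max_modulus_def using that by (intro cSUP_least B) auto
  then show "f \<in> Hinf"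
    unfolding Hinf_def using assms(1) by (auto intro!: bdd_aboveI2[of _ _ B])
  show "Hinf_norm f \<le> B"
    unfolding Hinf_norm_def by (rule cSUP_least) (use m in auto)
qed

lemma cmod_le_Hinf_norm:
  assumes f: "f \<in> Hinf" and z: "z \<in> \<bbbD>"
  shows "cmod (f z) \<le> Hinf_norm f"
proof -
  have cont: "continuous_on \<bbbD> f"
    using f by (auto simp: Hinf_def holomorphic_on_imp_continuous_on)
  have *: "cmod (f w) \<le> Hinf_norm f" if w: "w \<in> \<bbbD>" "w \<noteq> 0" for w
  proof -
    have "continuous_on {0..2 * pi} (\<lambda>\<theta>. cmod (f (of_real (cmod w) * cis \<theta>)))"
      using w by (intro continuous_intros continuous_on_compose2[OF cont]) auto
    then have "bdd_above ((\<lambda>\<theta>. cmod (f (of_real (cmod w) * cis \<theta>))) ` {0..2 * pi})"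
      by (intro bounded_imp_bdd_above compact_imp_bounded compact_continuous_image) auto
    then have "cmod (f (of_real (cmod w) * cis (Arg2pi w))) \<le> max_modulus (cmod w) f"
      unfolding max_modulus_def
      by (rule cSUP_upper[rotated]) (use Arg2pi_ge_0[of w] Arg2pi_lt_2pi[of w] in auto)
    moreover have "of_real (cmod w) * cis (Arg2pi w) = w"
      using Arg2pi_eq[of w] by (simp add: cis_conv_exp mult_ac)
    ultimately have "cmod (f w) \<le> max_modulus (cmod w) f"
      by simp
    also have "\<dots> \<le> Hinf_norm f"
      unfolding Hinf_norm_def by (rule cSUP_upper) (use f w in \<open>auto simp: Hinf_def\<close>)
    finally show ?thesis .
  qed
  show ?thesis
  proof (cases "z = 0")
    \<comment> \<open>The circles in \<open>Hinf_norm\<close> have positive radius, so the value at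
      0 is reached by continuity along the points \<open>1 / (n + 2)\<close>.\<close>
    case True
    have "(\<lambda>n. 1 / of_nat (Suc (Suc n)) :: complex) \<longlonglongrightarrow> 0"
      using LIMSEQ_Suc[OF LIMSEQ_inverse_real_of_nat[THEN tendsto_of_real[where 'a = complex]]]
      by (simp add: inverse_eq_divide)
    moreover have "isCont f 0"
      using cont by (simp add: continuous_on_eq_continuous_at)
    ultimately have "(\<lambda>n. f (1 / of_nat (Suc (Suc n)))) \<longlonglongrightarrow> f 0"
      by (rule isCont_tendsto_compose[rotated])
    then have "(\<lambda>n. cmod (f (1 / of_nat (Suc (Suc n))))) \<longlonglongrightarrow> cmod (f 0)"
      by (rule tendsto_norm)
    then show ?thesis
      unfolding True
      by (rule LIMSEQ_le_const2) (auto intro!: exI[of _ 0] * simp: norm_divide simp del: of_nat_Suc)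
  qed (use * z in auto)
qed

lemma cmod_deriv_le_Hinf_norm:
  assumes f: "f \<in> Hinf" and a: "a \<in> \<bbbD>"
  shows "cmod (deriv f a) \<le> 2 * Hinf_norm f / (1 - cmod a)"
proof -
  \<comment> \<open>Half the distance from \<open>a\<close> to the boundary keeps the closed disc of
    Cauchy's estimate inside the domain; it is the source of the factor 2.\<close>
  define r where "r = (1 - cmod a) / 2"
  have r: "r > 0" "cball a r \<subseteq> \<bbbD>"
    using a by (auto simp: r_def cball_subset_ball_iff field_simps)
  have hol: "f holomorphic_on \<bbbD>"
    using f by (auto simp: Hinf_def)
  have "cmod ((deriv ^^ 1) f a) \<le> fact 1 * Hinf_norm f / r ^ 1"
  proof (rule Cauchy_inequality)
    show "f holomorphic_on ball a r" "continuous_on (cball a r) f"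
      using r ball_subset_cball[of a r]
      by (intro holomorphic_on_subset[OF hol] holomorphic_on_imp_continuous_on; blast)+
    show "cmod (f x) \<le> Hinf_norm f" if "cmod (a - x) = r" for x
      using that r by (intro cmod_le_Hinf_norm f) (auto simp: dist_norm)
  qed fact
  then show ?thesis by (simp add: r_def mult.commute)
qed

lemma Hinf_diff: "f \<in> Hinf \<Longrightarrow> g \<in> Hinf \<Longrightarrow> (\<lambda>z. f z - g z) \<in> Hinf"
  by (rule HinfI[where B = "Hinf_norm f + Hinf_norm g"])
    (auto simp: Hinf_def intro!: holomorphic_intros norm_triangle_le_diff add_mono cmod_le_Hinf_norm)

text \<open>
  Normalised so that its norm in each of the three spaces is bounded independently of \<open>a\<close>.
\<close>

definition test_fun :: "real \<Rightarrow> nat \<Rightarrow> complex \<Rightarrow> complex \<Rightarrow> complex"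
  where "test_fun p k a z = of_real ((1 - cmod a) powr (real k - 1 / p)) / (1 - cnj a * z) ^ k"

text \<open>The later estimates use these bounds to trade powers of
  \<open>cmod (1 - cnj a * z)\<close> for powers of quantities that depend on the moduli
  alone.\<close>

lemma one_minus_cnj_mult:
  assumes "a \<in> \<bbbD>" "z \<in> \<bbbD>"
  shows "1 - cmod a * cmod z \<le> cmod (1 - cnj a * z)" "0 < 1 - cmod a * cmod z"
    "1 - cmod a \<le> 1 - cmod a * cmod z" "1 - cmod z \<le> 1 - cmod a * cmod z" "1 - cnj a * z \<noteq> 0"
proof -
  show 1: "1 - cmod a * cmod z \<le> cmod (1 - cnj a * z)"
    using norm_triangle_ineq2[of 1 "cnj a * z"] by (simp add: norm_mult)
  have "cmod a * cmod z \<le> cmod a * 1" "cmod a * cmod z \<le> 1 * cmod z"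
    using assms mult_left_mono[of "cmod z" 1 "cmod a"] mult_right_mono[of "cmod a" 1 "cmod z"] by auto
  moreover from this show 2: "0 < 1 - cmod a * cmod z"
    using assms by auto
  ultimately show "1 - cmod a \<le> 1 - cmod a * cmod z" "1 - cmod z \<le> 1 - cmod a * cmod z"
    by auto
  show "1 - cnj a * z \<noteq> 0"
    using 1 2 by auto
qed

lemma test_fun_holomorphic [holomorphic_intros]:
  assumes "a \<in> \<bbbD>"
  shows "test_fun p k a holomorphic_on \<bbbD>"
proof -
  have "(\<lambda>z. of_real ((1 - cmod a) powr (real k - 1 / p)) / (1 - cnj a * z) ^ k) holomorphic_on \<bbbD>"
    using one_minus_cnj_mult(5)[OF assms] by (intro holomorphic_intros) auto
  then show ?thesis
    by (simp add: test_fun_def[abs_def])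
qed

text \<open>At \<open>a\<close> the derivative of \<open>T_op g (test_fun p k a)\<close> is the test
  function's value times \<open>deriv g a\<close>. Since \<open>1 - (cmod a)\<^sup>2\<close> is at
  most \<open>2 * (1 - cmod a)\<close>, that value has modulus at least
  \<open>(1 - cmod a) powr (- 1 / p) / 2 ^ k\<close>; Cauchy's estimate costs a further
  \<open>2 / (1 - cmod a)\<close>.\<close>

lemma cmod_deriv_symbol_le:
  assumes a: "a \<in> \<bbbD>" and g: "g holomorphic_on \<bbbD>" and T: "T_op g (test_fun p k a) \<in> Hinf"
  shows "cmod (deriv g a) \<le> 2 ^ Suc k * (1 - cmod a) powr (1 / p - 1) * Hinf_norm (T_op g (test_fun p k a))"
proof -
  let ?N = "Hinf_norm (T_op g (test_fun p k a))"
  define d where "d = 1 - cmod a"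
  have d: "d > 0" using a by (simp add: d_def)
  have "1 - cnj a * a = of_real (1 - (cmod a)\<^sup>2)"
    using complex_norm_square[of a] by (simp add: mult.commute)
  then have "cmod (1 - cnj a * a) = \<bar>1 - (cmod a)\<^sup>2\<bar>"
    by (simp only: norm_of_real)
  also have "\<dots> = d * (1 + cmod a)"
    using a mult_le_one[of "cmod a" "cmod a"] by (simp add: d_def power2_eq_square algebra_simps)
  also have "\<dots> \<le> d * 2"
    using a d by (intro mult_left_mono) auto
  finally have *: "cmod (1 - cnj a * a) ^ k \<le> (d * 2) ^ k"
    by (rule power_mono) simp
  have pos: "0 < cmod (1 - cnj a * a) ^ k"
    using one_minus_cnj_mult(5)[OF a a] by simp
  have "d powr (real k - 1 / p) * cmod (deriv g a) / (d * 2) ^ k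
      \<le> d powr (real k - 1 / p) * cmod (deriv g a) / cmod (1 - cnj a * a) ^ k"
    using * pos by (intro divide_left_mono) auto
  also have "\<dots> = cmod (test_fun p k a a * deriv g a)"
    by (simp add: d_def test_fun_def norm_mult norm_divide norm_power)
  also have "test_fun p k a a * deriv g a = deriv (T_op g (test_fun p k a)) a"
    by (intro DERIV_imp_deriv[symmetric] T_op_has_field_derivative test_fun_holomorphic a g)
  also have "cmod \<dots> \<le> 2 * ?N / d"
    unfolding d_def by (rule cmod_deriv_le_Hinf_norm[OF T a])
  finally have "cmod (deriv g a) * (d powr (real k - 1 / p) / d powr real k) \<le> 2 ^ Suc k * ?N / d powr 1"
    using d by (simp add: powr_realpow power_mult_distrib field_simps)
  also have "d powr (real k - 1 / p) / d powr real k = d powr (- 1 / p)"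
    by (simp add: powr_diff[symmetric])
  finally have "cmod (deriv g a) * d powr (- 1 / p) * d powr (1 / p) \<le> 2 ^ Suc k * ?N / d powr 1 * d powr (1 / p)"
    by (rule mult_right_mono) simp
  then show ?thesis
    using d unfolding d_def[symmetric] by (simp add: powr_diff powr_minus field_simps)
qed

section \<open>Vanishing of a holomorphic function from its boundary behaviour\<close>

text \<open>Each \<open>a n\<close> maximises \<open>cmod (h z)\<close> on its own circle, by
  compactness. A bound at these points therefore controls whole circles, which is what the maximum
  principle requires.\<close>

lemma exists_maximising_sequence:
  assumes "h holomorphic_on \<bbbD>"
  obtains a where "\<And>n. a n \<in> \<bbbD>" "(\<lambda>n. cmod (a n)) \<longlonglongrightarrow> 1"
    "\<And>n z. cmod z = cmod (a n) \<Longrightarrow> cmod (h z) \<le> cmod (h (a n))"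
proof -
  \<comment> \<open>The first radius is 0; its sphere is the single point 0 and so still
    nonempty.\<close>
  define r where "r n = 1 - 1 / real (Suc n)" for n
  have r: "0 \<le> r n" "r n < 1" for n
    by (simp_all add: r_def)
  have "\<exists>a\<in>sphere 0 (r n). \<forall>z\<in>sphere 0 (r n). cmod (h z) \<le> cmod (h a)" for n
  proof (rule continuous_attains_sup)
    show "sphere (0 :: complex) (r n) \<noteq> {}"
      using r(1)[of n] by auto
    show "continuous_on (sphere 0 (r n)) (\<lambda>z. cmod (h z))"
      using r(2)[of n] by (intro continuous_intros holomorphic_on_imp_continuous_on holomorphic_on_subset[OF assms]) auto
  qed auto
  then obtain a where a: "\<And>n. a n \<in> sphere 0 (r n)" "\<And>n z. z \<in> sphere 0 (r n) \<Longrightarrow> cmod (h z) \<le> cmod (h (a n))"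
    by metis
  have "r \<longlonglongrightarrow> 1 - 0"
    unfolding r_def[abs_def] using LIMSEQ_inverse_real_of_nat
    by (intro tendsto_intros) (simp add: inverse_eq_divide)
  moreover have "cmod (a n) = r n" for n
    using a(1)[of n] by simp
  ultimately show ?thesis
    using a r by (intro that[of a]) auto
qed

text \<open>Once the circle through \<open>a n\<close> encloses \<open>z\<close>, the maximum
  modulus principle gives \<open>cmod (h z) \<le> cmod (h (a n))\<close>, and the right-hand side
  tends to 0.\<close>

lemma holomorphic_eq_0I:
  assumes h: "h holomorphic_on \<bbbD>" and a: "\<And>n. a n \<in> \<bbbD>" "(\<lambda>n. cmod (a n)) \<longlonglongrightarrow> 1"
    and max: "\<And>n z. cmod z = cmod (a n) \<Longrightarrow> cmod (h z) \<le> cmod (h (a n))"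
    and lim: "(\<lambda>n. h (a n)) \<longlonglongrightarrow> 0" and z: "z \<in> \<bbbD>"
  shows "h z = 0"
proof -
  have "\<forall>\<^sub>F n in sequentially. cmod z < cmod (a n)"
    using order_tendstoD(1)[OF a(2)] z by simp
  then have "\<forall>\<^sub>F n in sequentially. cmod (h z) \<le> cmod (h (a n))"
  proof eventually_elim
    case (elim n)
    have sub: "cball 0 (cmod (a n)) \<subseteq> \<bbbD>"
      using a(1)[of n] by auto
    show ?case
    proof (rule maximum_modulus_frontier[where f = h and S = "cball 0 (cmod (a n))"])
      show "h holomorphic_on interior (cball 0 (cmod (a n)))"
        using h sub interior_subset by (blast intro: holomorphic_on_subset)
      show "continuous_on (closure (cball 0 (cmod (a n)))) h"
        using h sub by (simp add: holomorphic_on_imp_continuous_on[OF holomorphic_on_subset])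
      have "frontier (cball 0 (cmod (a n))) = sphere (0 :: complex) (cmod (a n))"
        by (rule frontier_cball)
      then show "cmod (h w) \<le> cmod (h (a n))" if "w \<in> frontier (cball 0 (cmod (a n)))" for w
        using that by (intro max) auto
    qed (use elim in auto)
  qed
  then have "cmod (h z) \<le> cmod 0"
    using tendsto_norm[OF lim] by (intro tendsto_lowerbound[of "\<lambda>n. cmod (h (a n))"]) auto
  then show ?thesis by simp
qed

lemma const_on_discI:
  assumes g: "g holomorphic_on \<bbbD>" and "\<And>z. z \<in> \<bbbD> \<Longrightarrow> deriv g z = 0"
  shows "g \<in> const_on_disc"
proof -
  have "(g has_field_derivative 0) (at z within \<bbbD>)" if "z \<in> \<bbbD>" for z
    using holomorphic_derivI[OF g open_ball that] assms(2)[OF that] by simp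
  then have "\<exists>c. \<forall>z\<in>\<bbbD>. g z = c"
    by (intro has_field_derivative_zero_constant) auto
  then show ?thesis by (simp add: const_on_disc_def)
qed

section \<open>Constant symbols\<close>

lemma T_op_const:
  assumes "g \<in> const_on_disc"
  shows "g holomorphic_on \<bbbD>" and "z \<in> \<bbbD> \<Longrightarrow> T_op g f z = 0"
proof -
  obtain c where c: "\<And>z. z \<in> \<bbbD> \<Longrightarrow> g z = c"
    using assms by (auto simp: const_on_disc_def)
  then show hol: "g holomorphic_on \<bbbD>"
    by (intro holomorphic_transform[OF holomorphic_on_const[of c]]) simp
  have d: "deriv g w = 0" if "w \<in> \<bbbD>" for w
  proof -
    have "(g has_field_derivative 0) (at w)"
      by (rule has_field_derivative_transform_within_open[OF DERIV_const open_ball that]) (simp add: c)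
    then show ?thesis by (rule DERIV_imp_deriv)
  qed
  show "T_op g f z = 0" if z: "z \<in> \<bbbD>"
  proof -
    have "contour_integral (linepath 0 z) (\<lambda>\<zeta>. f \<zeta> * deriv g \<zeta>) = contour_integral (linepath 0 z) (\<lambda>\<zeta>. 0)"
    proof (rule contour_integral_eq)
      fix w assume "w \<in> path_image (linepath 0 z)"
      moreover have "closed_segment 0 z \<subseteq> \<bbbD>"
        using z by (intro closed_segment_subset) auto
      ultimately show "f w * deriv g w = 0"
        using d by auto
    qed
    then show ?thesis
      by (simp add: T_op_def)
  qed
qed

lemma Hinf_zero_on_disc:
  assumes "\<And>z. z \<in> \<bbbD> \<Longrightarrow> f z = 0"
  shows "f \<in> Hinf" "Hinf_norm f = 0"
proof -
  have hol: "f holomorphic_on \<bbbD>"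
    using assms by (intro holomorphic_transform[OF holomorphic_on_const[of 0]]) simp
  then show F: "f \<in> Hinf"
    by (rule HinfI[where B = 0]) (simp add: assms)
  show "Hinf_norm f = 0"
    using Hinf_norm_le[OF hol, of 0] cmod_le_Hinf_norm[OF F, of 0] assms by (intro antisym) auto
qed

lemma const_on_disc_subset_T_bounded: "const_on_disc \<subseteq> T_bounded X N"
  unfolding T_bounded_def
  using T_op_const Hinf_zero_on_disc by (auto intro!: exI[of _ 0])

lemma const_on_disc_subset_T_compact: "const_on_disc \<subseteq> T_compact X N"
proof
  fix g assume g: "g \<in> const_on_disc"
  have "\<exists>k :: nat \<Rightarrow> nat. \<exists>h\<in>Hinf. strict_mono k \<and> (\<lambda>n. Hinf_norm (\<lambda>z. T_op g (F (k n)) z - h z)) \<longlonglongrightarrow> 0" for F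
  proof (intro exI[of _ id] bexI[of _ "\<lambda>_. 0"] conjI)
    have "Hinf_norm (\<lambda>z. T_op g (F (id n)) z - 0) = 0" for n
      by (rule Hinf_zero_on_disc) (simp add: T_op_const[OF g])
    then show "(\<lambda>n. Hinf_norm (\<lambda>z. T_op g (F (id n)) z - 0)) \<longlonglongrightarrow> 0"
      by simp
  qed (auto simp: strict_mono_def intro: Hinf_zero_on_disc)
  then show "g \<in> T_compact X N"
    unfolding T_compact_def using T_op_const[OF g] Hinf_zero_on_disc(1) by auto
qed

section \<open>Exclusion of nonconstant symbols\<close>

text \<open>With \<open>X\<close> and \<open>N\<close> abstract, a concrete space only has to supply
  uniform bounds for its test functions. As \<open>p < 1\<close>, the exponent
  \<open>1 / p - 1\<close> is positive, so the bound on \<open>deriv g (a n)\<close> tends to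
  0.\<close>

lemma T_bounded_eq_const_on_disc:
  assumes p: "0 < p" "p < 1"
    and X: "\<And>a. a \<in> \<bbbD> \<Longrightarrow> test_fun p k a \<in> X"
    and N: "\<And>a. a \<in> \<bbbD> \<Longrightarrow> 0 \<le> N (test_fun p k a) \<and> N (test_fun p k a) \<le> C"
  shows "T_bounded X N = const_on_disc"
proof (intro antisym const_on_disc_subset_T_bounded subsetI)
  fix g assume g: "g \<in> T_bounded X N"
  then have hol: "g holomorphic_on \<bbbD>" and T: "\<And>f. f \<in> X \<Longrightarrow> T_op g f \<in> Hinf"
    by (auto simp: T_bounded_def)
  obtain C' where C': "\<And>f. f \<in> X \<Longrightarrow> Hinf_norm (T_op g f) \<le> C' * N f"
    using g by (auto simp: T_bounded_def)
  have hol': "deriv g holomorphic_on \<bbbD>"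
    by (intro holomorphic_intros hol) auto
  obtain a where a: "\<And>n. a n \<in> \<bbbD>" "(\<lambda>n. cmod (a n)) \<longlonglongrightarrow> 1"
    "\<And>n z. cmod z = cmod (a n) \<Longrightarrow> cmod (deriv g z) \<le> cmod (deriv g (a n))"
    using exists_maximising_sequence[OF hol'] by blast
  have "cmod (deriv g (a n)) \<le> 2 ^ Suc k * (1 - cmod (a n)) powr (1 / p - 1) * (\<bar>C'\<bar> * C)" for n
  proof -
    have "Hinf_norm (T_op g (test_fun p k (a n))) \<le> C' * N (test_fun p k (a n))"
      by (intro C' X a)
    \<comment> \<open>\<open>T_bounded\<close> admits any real constant, so \<open>C'\<close> could
      be negative; the absolute value restores monotonicity.\<close>
    also have "\<dots> \<le> \<bar>C'\<bar> * C"
      using N[OF a(1)] by (intro mult_mono) auto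
    finally show ?thesis
      by (intro order_trans[OF cmod_deriv_symbol_le[OF a(1) hol T[OF X[OF a(1)]]]] mult_left_mono) auto
  qed
  moreover have "(\<lambda>n. 2 ^ Suc k * (1 - cmod (a n)) powr (1 / p - 1) * (\<bar>C'\<bar> * C)) \<longlonglongrightarrow> 2 ^ Suc k * 0 * (\<bar>C'\<bar> * C)"
  proof (intro tendsto_intros)
    have "(\<lambda>n. 1 - cmod (a n)) \<longlonglongrightarrow> 1 - 1"
      by (intro tendsto_intros a)
    then show "(\<lambda>n. (1 - cmod (a n)) powr (1 / p - 1)) \<longlonglongrightarrow> 0"
      using p a(1) by (intro tendsto_zero_powrI[OF _ tendsto_const]) (auto simp: less_imp_le)
  qed
  ultimately have "(\<lambda>n. deriv g (a n)) \<longlonglongrightarrow> 0"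
    by (intro Lim_null_comparison[of "\<lambda>n. deriv g (a n)", OF always_eventually]) simp_all
  then show "g \<in> const_on_disc"
    using holomorphic_eq_0I[OF hol' a] by (intro const_on_discI hol)
qed

text \<open>For \<open>p = 1\<close> the estimate for \<open>deriv g\<close> has no decaying power
  left; the decay must come from the norms of the images. Compactness provides a norm limit
  \<open>h\<close> along a subsequence, and \<open>k > 1\<close> makes the images tend to 0
  pointwise, so \<open>h\<close> vanishes.\<close>

lemma T_compact_eq_const_on_disc:
  assumes k: "k > 1"
    and X: "\<And>a. a \<in> \<bbbD> \<Longrightarrow> test_fun 1 k a \<in> X"
    and N: "\<And>a. a \<in> \<bbbD> \<Longrightarrow> N (test_fun 1 k a) \<le> C"
  shows "T_compact X N = const_on_disc"
proof (intro antisym const_on_disc_subset_T_compact subsetI)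
  fix g assume g: "g \<in> T_compact X N"
  then have hol: "g holomorphic_on \<bbbD>" and T: "\<And>f. f \<in> X \<Longrightarrow> T_op g f \<in> Hinf"
    by (auto simp: T_compact_def)
  have hol': "deriv g holomorphic_on \<bbbD>"
    by (intro holomorphic_intros hol) auto
  obtain a where a: "\<And>n. a n \<in> \<bbbD>" "(\<lambda>n. cmod (a n)) \<longlonglongrightarrow> 1"
    "\<And>n z. cmod z = cmod (a n) \<Longrightarrow> cmod (deriv g z) \<le> cmod (deriv g (a n))"
    using exists_maximising_sequence[OF hol'] by blast
  define F where "F n = test_fun 1 k (a n)" for n
  have FX: "F n \<in> X" "N (F n) \<le> C" "F n holomorphic_on \<bbbD>" for n
    using X[OF a(1)] N[OF a(1)] test_fun_holomorphic[OF a(1)] by (auto simp: F_def)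
  then obtain j h where h: "h \<in> Hinf" and j: "strict_mono j"
    and lim: "(\<lambda>n. Hinf_norm (\<lambda>z. T_op g (F (j n)) z - h z)) \<longlonglongrightarrow> 0"
    using g unfolding T_compact_def by blast
  have diff: "cmod (T_op g (F (j n)) z - h z) \<le> Hinf_norm (\<lambda>z. T_op g (F (j n)) z - h z)" if "z \<in> \<bbbD>" for n z
    by (rule cmod_le_Hinf_norm[OF Hinf_diff[OF T[OF FX(1)] h] that])
  have aj: "(\<lambda>n. cmod (a (j n))) \<longlonglongrightarrow> 1"
    using LIMSEQ_subseq_LIMSEQ[OF a(2) j] by (simp add: o_def)
  have h0: "h z = 0" if z: "z \<in> \<bbbD>" for z
  proof -
    have sub: "cball 0 (cmod z) \<subseteq> \<bbbD>"
      using z by auto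
    have "compact (deriv g ` cball 0 (cmod z))"
      by (intro compact_continuous_image holomorphic_on_imp_continuous_on holomorphic_on_subset[OF hol' sub]) auto
    then have "bounded (deriv g ` cball 0 (cmod z))"
      by (rule compact_imp_bounded)
    then obtain M where M: "\<And>w. cmod w \<le> cmod z \<Longrightarrow> cmod (deriv g w) \<le> M"
      unfolding bounded_iff by (metis (no_types, lifting) image_eqI mem_cball_0)
    have M0: "M \<ge> 0"
      using order_trans[OF norm_ge_zero M[of 0]] by simp
    \<comment> \<open>On the disc of radius \<open>cmod z\<close> the denominator of the test
      function stays at least \<open>(1 - cmod z) ^ k\<close>, so only its numerator depends on
      \<open>n\<close>, and that tends to 0.\<close>
    let ?B = "\<lambda>n. (1 - cmod (a (j n))) powr (real k - 1) * (M / (1 - cmod z) ^ k)"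
    have le: "cmod (T_op g (F (j n)) z) \<le> ?B n" for n
    proof (rule cmod_T_op_le[OF FX(3) hol z])
      show "0 \<le> ?B n"
        using M0 z by simp
      fix w assume w: "cmod w \<le> cmod z"
      then have wD: "w \<in> \<bbbD>" using z by auto
      have "1 - cmod z \<le> cmod (1 - cnj (a (j n)) * w)"
        using one_minus_cnj_mult[OF a(1)[of "j n"] wD] w by linarith
      then have "(1 - cmod z) ^ k \<le> cmod (1 - cnj (a (j n)) * w) ^ k"
        using z by (intro power_mono) auto
      then have "(1 - cmod (a (j n))) powr (real k - 1) * (cmod (deriv g w) / cmod (1 - cnj (a (j n)) * w) ^ k)
          \<le> ?B n"
        using M[OF w] M0 z by (intro mult_left_mono frac_le) auto
      then show "cmod (F (j n) w * deriv g w) \<le> ?B n"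
        by (simp add: F_def test_fun_def norm_mult norm_divide norm_power)
    qed
    have "(\<lambda>n. 1 - cmod (a (j n))) \<longlonglongrightarrow> 1 - 1"
      by (intro tendsto_intros aj)
    then have "(\<lambda>n. (1 - cmod (a (j n))) powr (real k - 1)) \<longlonglongrightarrow> 0"
      using k a(1) by (intro tendsto_zero_powrI[OF _ tendsto_const]) (auto simp: less_imp_le)
    then have B0: "?B \<longlonglongrightarrow> 0"
      by (rule tendsto_mult_left_zero)
    have T0: "(\<lambda>n. T_op g (F (j n)) z) \<longlonglongrightarrow> 0"
      by (rule Lim_null_comparison[OF always_eventually[OF allI[OF le]] B0])
    have "(\<lambda>n. T_op g (F (j n)) z - h z) \<longlonglongrightarrow> 0"
      by (rule Lim_null_comparison[OF always_eventually[OF allI[OF diff[OF z]]] lim])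
    from tendsto_diff[OF T0 this] show ?thesis
      by (simp add: LIMSEQ_const_iff)
  qed
  have le: "cmod (deriv g (a (j n))) \<le> 2 ^ Suc k * Hinf_norm (\<lambda>z. T_op g (F (j n)) z - h z)" for n
  proof -
    have "cmod (deriv g (a (j n))) \<le> 2 ^ Suc k * Hinf_norm (T_op g (F (j n)))"
      \<comment> \<open>For \<open>p = 1\<close> the power of \<open>1 - cmod a\<close> has exponent
        0; it equals 1 because the base is nonzero.\<close>
      using cmod_deriv_symbol_le[OF a(1) hol, of 1 k "j n"] T[OF FX(1)] a(1)[of "j n"] by (auto simp: F_def)
    also have "Hinf_norm (T_op g (F (j n))) \<le> Hinf_norm (\<lambda>z. T_op g (F (j n)) z - h z)"
      using diff h0 by (intro Hinf_norm_le T_op_holomorphic FX hol) auto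
    finally show ?thesis
      by (simp add: mult_left_mono)
  qed
  have "(\<lambda>n. 2 ^ Suc k * Hinf_norm (\<lambda>z. T_op g (F (j n)) z - h z)) \<longlonglongrightarrow> 0"
    by (rule tendsto_mult_right_zero[OF lim])
  then have "(\<lambda>n. deriv g (a (j n))) \<longlonglongrightarrow> 0"
    by (rule Lim_null_comparison[OF always_eventually[OF allI[OF le]]])
  then show "g \<in> const_on_disc"
    by (intro const_on_discI hol holomorphic_eq_0I[OF hol' a(1) aj a(3)])
qed

subsection \<open>Test functions in Hardy and Hardy-Littlewood spaces\<close>

text \<open>This is Cauchy's integral formula at the centre, with the circle parametrised by the
  angle.\<close>

lemma circle_mean:
  assumes f: "f holomorphic_on cball 0 r" and r: "0 < r"
  shows "((\<lambda>\<theta>. f (of_real r * cis \<theta>)) has_integral 2 * of_real pi * f 0) {0..2 * pi}"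
proof -
  have "((\<lambda>u. f u / (u - 0)) has_contour_integral (2 * of_real pi * \<i> * f 0)) (circlepath 0 r)"
    by (rule Cauchy_integral_circlepath_simple[OF f]) (use r in simp)
  then have "((\<lambda>t. f (0 + r * cis t) / (0 + r * cis t - 0) * r * \<i> * cis t) has_integral 2 * of_real pi * \<i> * f 0) {0..2 * pi}"
    unfolding circlepath_def by (subst (asm) has_contour_integral_part_circlepath_iff) simp_all
  then have "((\<lambda>t. \<i> * f (r * cis t)) has_integral 2 * of_real pi * \<i> * f 0) {0..2 * pi}"
    by (rule has_integral_eq[rotated]) (use r in simp)
  from has_integral_mult_right[OF this, of "- \<i>"] show ?thesis
    by (simp add: algebra_simps)
qed

text \<open>On the unit circle \<open>(1 - (cmod b)\<^sup>2) / (cmod (1 - b * z))\<^sup>2\<close> is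
  the real part of \<open>(1 + b * z) / (1 - b * z)\<close>. This function is holomorphic on the
  closed disc with value 1 at 0, so the mean value property applies.\<close>

lemma poisson_integral:
  assumes b: "b \<in> \<bbbD>"
  shows "((\<lambda>\<theta>. 1 / (cmod (1 - b * cis \<theta>))\<^sup>2) has_integral 2 * pi / (1 - (cmod b)\<^sup>2)) {0..2 * pi}"
proof -
  define f where "f z = (1 + b * z) / (1 - b * z)" for z
  have lt1: "cmod (b * z) < 1" if "cmod z \<le> 1" for z
  proof -
    have "cmod (b * z) \<le> cmod b * 1"
      unfolding norm_mult using that by (intro mult_left_mono) auto
    then show ?thesis using b by simp
  qed
  have ne: "1 - b * z \<noteq> 0" if "cmod z \<le> 1" for z
    using lt1[OF that] by auto
  have "f holomorphic_on cball 0 1"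
    unfolding f_def by (intro holomorphic_intros) (use ne in auto)
  from has_integral_linear[OF circle_mean[OF this] bounded_linear_Re]
  have "((\<lambda>\<theta>. Re (f (cis \<theta>))) has_integral 2 * pi) {0..2 * pi}"
    by (simp add: o_def f_def)
  from has_integral_divide[OF this, of "1 - (cmod b)\<^sup>2"]
  have "((\<lambda>\<theta>. Re (f (cis \<theta>)) / (1 - (cmod b)\<^sup>2)) has_integral 2 * pi / (1 - (cmod b)\<^sup>2)) {0..2 * pi}" .
  moreover have "Re (f (cis \<theta>)) / (1 - (cmod b)\<^sup>2) = 1 / (cmod (1 - b * cis \<theta>))\<^sup>2" for \<theta>
  proof -
    define w where "w = b * cis \<theta>"
    have w: "cmod w = cmod b" "1 - w \<noteq> 0"
      using ne[of "cis \<theta>"] by (simp_all add: w_def norm_mult)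
    have "(cmod b)\<^sup>2 < 1"
      using b by (simp add: abs_square_less_1)
    then have pos: "1 - (cmod b)\<^sup>2 \<noteq> 0" by simp
    have "Re ((1 + w) / (1 - w)) = (1 - (cmod w)\<^sup>2) / (cmod (1 - w))\<^sup>2"
      unfolding Re_divide' cmod_power2 by (simp add: power2_eq_square algebra_simps)
    then show ?thesis
      using pos w by (simp add: f_def w_def)
  qed
  ultimately show ?thesis by simp
qed

text \<open>
  The exponent \<open>2\<close> is all that has to be integrated: the surplus \<open>kp - 2 \<ge> 0\<close> is absorbed by
  \<open>\<bar>1 - cnj a * z\<bar> \<ge> 1 - \<bar>a\<bar>\<close>.
\<close>

lemma test_fun_powr_le:
  assumes a: "a \<in> \<bbbD>" and z: "z \<in> \<bbbD>" and p: "0 < p" and k: "2 \<le> real k * p"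
  shows "cmod (test_fun p k a z) powr p \<le> (1 - cmod a) / (cmod (1 - cnj a * z))\<^sup>2"
proof -
  define d u where "d = 1 - cmod a" and "u = cmod (1 - cnj a * z)"
  have d: "d > 0" and du: "d \<le> u"
    using a one_minus_cnj_mult[OF a z] by (auto simp: d_def u_def)
  then have u: "u > 0" by simp
  have "cmod (test_fun p k a z) powr p = (d powr (real k - 1 / p) / u powr real k) powr p"
    using u by (simp add: test_fun_def norm_divide norm_power d_def u_def powr_realpow)
  also have "\<dots> = d powr (real k * p - 1) / u powr (real k * p)"
    using d u p by (simp add: powr_divide powr_powr algebra_simps)
  also have "u powr (real k * p) = u powr (real k * p - 2) * u powr 2"
    by (simp add: powr_add[symmetric])
  also have "d powr (real k * p - 1) / (u powr (real k * p - 2) * u powr 2)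
      \<le> d powr (real k * p - 1) / (d powr (real k * p - 2) * u powr 2)"
    using d u du k by (intro divide_left_mono mult_right_mono powr_mono2) auto
  also have "\<dots> = d powr ((real k * p - 1) - (real k * p - 2)) / u powr 2"
    unfolding powr_diff[of d "real k * p - 1"] by simp
  also have "\<dots> = d / u\<^sup>2"
    using d u powr_realpow[of u 2] by simp
  finally show ?thesis by (simp add: d_def u_def)
qed

text \<open>The Poisson integral with \<open>b = cnj a * r\<close> bounds the mean by
  \<open>(1 - cmod a) / (1 - (cmod a * r)\<^sup>2)\<close>, which is at most 1 because
  \<open>(cmod a * r)\<^sup>2 \<le> cmod a\<close>.\<close>

lemma hardy_mean_test_fun_le:
  assumes a: "a \<in> \<bbbD>" and r: "0 < r" "r < 1" and p: "0 < p" and k: "2 \<le> real k * p"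
  shows "hardy_mean p r (test_fun p k a) \<le> 1"
proof -
  have inD: "of_real r * cis \<theta> \<in> \<bbbD>" for \<theta>
    using r by simp
  have b: "cnj a * of_real r \<in> \<bbbD>"
    using a r mult_strict_mono[of "cmod a" 1 r 1] by (simp add: norm_mult)
  have int: "((\<lambda>\<theta>. (1 - cmod a) * (1 / (cmod (1 - cnj a * of_real r * cis \<theta>))\<^sup>2))
      has_integral (1 - cmod a) * (2 * pi / (1 - (cmod (cnj a * of_real r))\<^sup>2))) {0..2 * pi}"
    by (intro has_integral_mult_right poisson_integral b)
  have cont: "continuous_on {0..2 * pi} (\<lambda>\<theta>. cmod (test_fun p k a (of_real r * cis \<theta>)) powr p)"
    using p inD
    by (intro continuous_on_powr' continuous_intros
      continuous_on_compose2[OF holomorphic_on_imp_continuous_on[OF test_fun_holomorphic[OF a]]]) auto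
  have "integral {0..2 * pi} (\<lambda>\<theta>. cmod (test_fun p k a (of_real r * cis \<theta>)) powr p)
      \<le> (1 - cmod a) * (2 * pi / (1 - (cmod (cnj a * of_real r))\<^sup>2))"
    by (rule has_integral_le[OF integrable_integral[OF integrable_continuous_interval[OF cont]] int])
      (use test_fun_powr_le[OF a inD p k] in \<open>simp add: mult.assoc\<close>)
  also have "\<dots> \<le> 2 * pi"
  proof -
    have "cmod a * r * (cmod a * r) \<le> cmod a * 1 * 1"
      using a r by (intro mult_mono mult_le_one) (auto simp: mult_le_one)
    moreover have "cmod a < 1" using a by simp
    ultimately show ?thesis
      using r by (simp add: norm_mult power2_eq_square divide_le_eq mult_left_mono)
  qed
  finally have "1 / (2 * pi) * integral {0..2 * pi} (\<lambda>\<theta>. cmod (test_fun p k a (of_real r * cis \<theta>)) powr p) \<le> 1"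
    by (simp add: divide_le_eq)
  then show ?thesis
    unfolding hardy_mean_def using p Henstock_Kurzweil_Integration.integral_nonneg[OF integrable_continuous_interval[OF cont]]
    by (intro powr_le1) (auto simp: abs_mult)
qed

lemma hardy_mean_nonneg: "0 \<le> hardy_mean p r f"
  by (simp add: hardy_mean_def)

lemma hardy_mean_le_hardy_norm: "f \<in> hardy_space p \<Longrightarrow> 0 < r \<Longrightarrow> r < 1 \<Longrightarrow> hardy_mean p r f \<le> hardy_norm p f"
  unfolding hardy_norm_def by (rule cSUP_upper) (auto simp: hardy_space_def)

lemma test_fun_hardy:
  assumes a: "a \<in> \<bbbD>" and p: "0 < p" and k: "2 \<le> real k * p"
  shows "test_fun p k a \<in> hardy_space p" "0 \<le> hardy_norm p (test_fun p k a)" "hardy_norm p (test_fun p k a) \<le> 1"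
proof -
  show *: "test_fun p k a \<in> hardy_space p"
    unfolding hardy_space_def using a p k
    by (auto intro!: bdd_aboveI2[of _ _ 1] hardy_mean_test_fun_le test_fun_holomorphic)
  show "0 \<le> hardy_norm p (test_fun p k a)"
    using hardy_mean_nonneg[of p "1/2" "test_fun p k a"] hardy_mean_le_hardy_norm[OF *, of "1/2"] by simp
  show "hardy_norm p (test_fun p k a) \<le> 1"
    unfolding hardy_norm_def
    by (rule cSUP_least) (auto intro: hardy_mean_test_fun_le[OF a _ _ p k])
qed

section \<open>Taylor coefficients and the Hardy-Littlewood norm\<close>

lemma higher_deriv_test_fun:
  assumes a: "a \<in> \<bbbD>" and z: "z \<in> \<bbbD>"
  shows "(deriv ^^ n) (test_fun p k a) z =
    of_real ((1 - cmod a) powr (real k - 1 / p)) * pochhammer (of_nat k) n * cnj a ^ n / (1 - cnj a * z) ^ (k + n)"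
  using z
proof (induction n arbitrary: z)
  case 0
  then show ?case by (simp add: test_fun_def)
next
  case (Suc n)
  let ?c = "of_real ((1 - cmod a) powr (real k - 1 / p)) * pochhammer (of_nat k) n * cnj a ^ n :: complex"
  have nz: "1 - cnj a * z \<noteq> 0"
    by (rule one_minus_cnj_mult[OF a Suc.prems])
  \<comment> \<open>This matches the output of the quotient rule, including \<open>m = 0\<close>,
    where the truncated exponent \<open>m - 1\<close> is harmless thanks to the factor
    \<open>of_nat m\<close>.\<close>
  have pow: "c * (of_nat m * b) / w ^ Suc m = - (c * (of_nat m * w ^ (m - 1) * (- b))) / (w ^ m)\<^sup>2"
    if "w \<noteq> 0" for c b w :: complex and m
    using that by (cases m) (simp_all add: power2_eq_square field_simps)
  have "((\<lambda>z. ?c / (1 - cnj a * z) ^ (k + n)) has_field_derivative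
      ?c * (of_nat (k + n) * cnj a) / (1 - cnj a * z) ^ (k + Suc n)) (at z)"
    unfolding add_Suc_right pow[OF nz] using nz
    by (auto intro!: derivative_eq_intros simp: power2_eq_square)
  then have "((deriv ^^ n) (test_fun p k a) has_field_derivative
      ?c * (of_nat (k + n) * cnj a) / (1 - cnj a * z) ^ (k + Suc n)) (at z)"
    by (rule has_field_derivative_transform_within_open[OF _ open_ball Suc.prems]) (simp add: Suc.IH)
  from DERIV_imp_deriv[OF this] show ?case
    by (simp add: pochhammer_Suc mult_ac)
qed

text \<open>The quotient is the binomial coefficient of \<open>n + k - 1\<close> over
  \<open>n\<close>. Raising \<open>k\<close> by one multiplies it by \<open>(k + n) / k\<close>,
  which is at most \<open>n + 1\<close>.\<close>

lemma pochhammer_le: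
  assumes "k \<ge> 1"
  shows "pochhammer (real k) n / fact n \<le> real (n + 1) ^ (k - 1)"
  using assms
proof (induction k rule: nat_induct_at_least)
  case base
  show ?case by (simp add: pochhammer_fact[symmetric])
next
  case (Suc k)
  have "real k * pochhammer (real (Suc k)) n = pochhammer (real k) (Suc n)"
    by (simp add: pochhammer_rec add.commute)
  also have "\<dots> = pochhammer (real k) n * (real k + real n)"
    by (simp add: pochhammer_Suc)
  finally have "pochhammer (real (Suc k)) n / fact n = pochhammer (real k) n / fact n * ((real k + real n) / real k)"
    using Suc.hyps by (simp add: field_simps)
  also have "\<dots> \<le> real (n + 1) ^ (k - 1) * real (n + 1)"
  proof (intro mult_mono Suc.IH)
    have "real n * 1 \<le> real n * real k"
      using Suc.hyps by (intro mult_left_mono) auto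
    then show "(real k + real n) / real k \<le> real (n + 1)"
      using Suc.hyps by (simp add: field_simps)
  qed auto
  also have "\<dots> = real (n + 1) ^ (Suc k - 1)"
    using Suc.hyps by (cases k) simp_all
  finally show ?case .
qed

text \<open>The concave function \<open>x powr b\<close> lies below its tangent at 1; this is
  Young's inequality for \<open>x\<close> and 1 with weights \<open>b\<close> and
  \<open>1 - b\<close>.\<close>

lemma one_minus_powr_ge:
  fixes x b :: real
  assumes "0 \<le> x" "x < 1" "0 < b" "b \<le> 1"
  shows "b * (1 - x) \<le> 1 - x powr b"
proof (cases "x = 0")
  case False
  have "x powr b * 1 powr (1 - b) \<le> b * x + (1 - b) * 1"
    using assms False Youngs_inequality_0[of b "1 - b" x 1] by simp
  then show ?thesis by (simp add: algebra_simps)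
qed (use assms in auto)

text \<open>With \<open>y = x powr (p / s)\<close> the term is
  \<open>((n + 1) * y ^ n) powr (s - 1) * y ^ n\<close>. Here \<open>(n + 1) * y ^ n\<close> is at
  most the full geometric sum \<open>1 / (1 - y)\<close>, because the powers of \<open>y\<close>
  decrease. What remains is a geometric series with total \<open>(1 - y) powr (- s)\<close>, and
  \<open>1 - y\<close> is compared with \<open>1 - x\<close>.\<close>

lemma sum_powr_geometric_le:
  fixes x s p :: real
  assumes x: "0 \<le> x" "x < 1" and s: "1 \<le> s" and p: "0 < p" "p \<le> s"
  shows "summable (\<lambda>n. real (n + 1) powr (s - 1) * (x ^ n) powr p)"
    "(\<Sum>n. real (n + 1) powr (s - 1) * (x ^ n) powr p) \<le> (p / s * (1 - x)) powr (- s)"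
proof -
  define y where "y = x powr (p / s)"
  have y1: "p / s * (1 - x) \<le> 1 - y"
    unfolding y_def using x s p by (intro one_minus_powr_ge) auto
  moreover have "0 < p / s * (1 - x)"
    using x s p by simp
  ultimately have y: "0 \<le> y" "y < 1"
    by (simp_all add: y_def)
  have bound: "real (n + 1) powr (s - 1) * (x ^ n) powr p \<le> (1 / (1 - y)) powr (s - 1) * y ^ n" for n
  proof -
    have "(x ^ n) powr (p / s) = y ^ n"
      unfolding y_def using x by (induction n) (simp_all add: powr_mult)
    then have "(x ^ n) powr p = (y ^ n) powr s"
      using s powr_powr[of "x ^ n" "p / s" s] by simp
    also have "\<dots> = (y ^ n) powr (s - 1) * y ^ n"
      using y powr_add[of "y ^ n" "s - 1" 1] by simp
    finally have "real (n + 1) powr (s - 1) * (x ^ n) powr p = (real (n + 1) * y ^ n) powr (s - 1) * y ^ n"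
      using y by (simp add: powr_mult)
    moreover have "real (n + 1) * y ^ n \<le> 1 / (1 - y)"
    proof -
      have "real (n + 1) * y ^ n = (\<Sum>i\<le>n. y ^ n)"
        by simp
      also have "\<dots> \<le> (\<Sum>i\<le>n. y ^ i)"
        using y by (intro sum_mono power_decreasing) auto
      also have "\<dots> \<le> (\<Sum>i. y ^ i)"
        using y by (intro sum_le_suminf) auto
      also have "\<dots> = 1 / (1 - y)"
        using y by (intro suminf_geometric) auto
      finally show ?thesis .
    qed
    ultimately show ?thesis
      using y s by (auto intro!: mult_right_mono powr_mono2)
  qed
  have sum: "summable (\<lambda>n. (1 / (1 - y)) powr (s - 1) * y ^ n)"
    using y by (intro summable_mult) auto
  show summ: "summable (\<lambda>n. real (n + 1) powr (s - 1) * (x ^ n) powr p)"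
    by (rule summable_comparison_test'[OF sum]) (use bound in simp)
  have "(\<Sum>n. real (n + 1) powr (s - 1) * (x ^ n) powr p) \<le> (\<Sum>n. (1 / (1 - y)) powr (s - 1) * y ^ n)"
    by (rule suminf_le[OF bound summ sum])
  also have "\<dots> = (1 / (1 - y)) powr (s - 1) * (1 / (1 - y))"
    using y by (subst suminf_mult) (auto simp: suminf_geometric)
  also have "\<dots> = (1 / (1 - y)) powr s"
    using y powr_add[of "1 / (1 - y)" "s - 1" 1] by simp
  also have "\<dots> = (1 - y) powr (- s)"
    using y by (simp add: powr_minus powr_divide inverse_eq_divide)
  also have "\<dots> \<le> (p / s * (1 - x)) powr (- s)"
    using y1 x s p by (intro powr_mono2') auto
  finally show "(\<Sum>n. real (n + 1) powr (s - 1) * (x ^ n) powr p) \<le> (p / s * (1 - x)) powr (- s)" .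
qed

text \<open>With \<open>s = k * p - 1\<close>, the coefficient bound raised to the power
  \<open>p\<close> and multiplied by the weight is
  \<open>d powr s * (n + 1) powr (s - 1) * (cmod a ^ n) powr p\<close>. The series contributes
  \<open>d powr (- s)\<close> up to a constant, which cancels the normalisation. The condition
  \<open>2 \<le> k * p\<close> is exactly \<open>1 \<le> s\<close>.\<close>

lemma test_fun_HL:
  assumes a: "a \<in> \<bbbD>" and p: "0 < p" "p \<le> 1" and k: "2 \<le> real k * p"
  shows "test_fun p k a \<in> HL_space p" "0 \<le> HL_norm p (test_fun p k a)"
    "HL_norm p (test_fun p k a) \<le> ((p / (real k * p - 1)) powr (- (real k * p - 1))) powr (1 / p)"
proof -
  define d s where "d = 1 - cmod a" and "s = real k * p - 1"
  have d: "0 < d" using a by (simp add: d_def)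
  have s: "1 \<le> s" "p \<le> s" using p k by (auto simp: s_def)
  have k1: "k \<ge> 1" using k by (cases k) auto
  define T where "T n = cmod (maclaurin_coeff (test_fun p k a) n) powr p * real (n + 1) powr (p - 2)" for n
  define B where "B n = d powr s * (real (n + 1) powr (s - 1) * (cmod a ^ n) powr p)" for n
  have TB: "T n \<le> B n" for n
  proof -
    have "cmod (maclaurin_coeff (test_fun p k a) n)
        = d powr (real k - 1 / p) * (pochhammer (real k) n / fact n) * cmod a ^ n"
      unfolding maclaurin_coeff_def higher_deriv_test_fun[OF a centre_in_ball[THEN iffD2, OF zero_less_one]]
      using pochhammer_of_nat[of k n, where 'a = complex] pochhammer_of_nat[of k n, where 'a = real]
      by (simp add: norm_mult norm_divide norm_power d_def)
    also have "\<dots> \<le> d powr (real k - 1 / p) * real (n + 1) ^ (k - 1) * cmod a ^ n"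
      by (intro mult_right_mono mult_left_mono pochhammer_le k1) auto
    finally have "cmod (maclaurin_coeff (test_fun p k a) n) powr p
        \<le> (d powr (real k - 1 / p) * real (n + 1) ^ (k - 1) * cmod a ^ n) powr p"
      using p by (intro powr_mono2) auto
    also have "\<dots> = d powr s * real (n + 1) powr (real (k - 1) * p) * (cmod a ^ n) powr p"
      using p d by (simp add: powr_mult powr_powr powr_realpow[symmetric] s_def algebra_simps del: of_nat_Suc of_nat_add)
    finally have "T n \<le> d powr s * real (n + 1) powr (real (k - 1) * p) * (cmod a ^ n) powr p * real (n + 1) powr (p - 2)"
      unfolding T_def by (intro mult_right_mono) auto
    also have "\<dots> = d powr s * ((real (n + 1) powr (real (k - 1) * p) * real (n + 1) powr (p - 2)) * (cmod a ^ n) powr p)"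
      by (simp only: mult_ac)
    also have "real (n + 1) powr (real (k - 1) * p) * real (n + 1) powr (p - 2) = real (n + 1) powr (s - 1)"
      using k1 by (simp add: powr_add[symmetric] s_def of_nat_diff algebra_simps)
    finally show ?thesis by (simp only: B_def)
  qed
  have T0: "0 \<le> T n" for n by (simp add: T_def)
  note * = sum_powr_geometric_le[of "cmod a" s p]
  have sB: "summable B"
    unfolding B_def using a p s by (intro summable_mult *) auto
  have sT: "summable T"
    by (rule summable_comparison_test'[OF sB]) (use TB T0 in simp)
  have "(\<Sum>n. T n) \<le> (\<Sum>n. B n)"
    by (rule suminf_le[OF TB sT sB])
  also have "\<dots> = d powr s * (\<Sum>n. real (n + 1) powr (s - 1) * (cmod a ^ n) powr p)"
    unfolding B_def using a p s by (intro suminf_mult *) auto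
  also have "\<dots> \<le> d powr s * (p / s * (1 - cmod a)) powr (- s)"
    using a p s by (intro mult_left_mono *) auto
  also have "\<dots> = (p / s) powr (- s)"
    using d p s powr_mult[of "p / s" d "- s"] powr_add[of d s "- s"] by (simp add: d_def[symmetric] mult_ac)
  finally have le: "(\<Sum>n. T n) \<le> (p / s) powr (- s)" .
  have "(\<Sum>n. T n) powr (1 / p) \<le> ((p / s) powr (- s)) powr (1 / p)"
    using le p suminf_nonneg[OF sT T0] by (intro powr_mono2) auto
  then show "HL_norm p (test_fun p k a) \<le> ((p / (real k * p - 1)) powr (- (real k * p - 1))) powr (1 / p)"
    unfolding HL_norm_def T_def s_def .
  show "test_fun p k a \<in> HL_space p"
    unfolding HL_space_def using sT test_fun_holomorphic[OF a] by (simp add: T_def[abs_def])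
  show "0 \<le> HL_norm p (test_fun p k a)"
    by (simp add: HL_norm_def)
qed

subsection \<open>Polynomial symbols\<close>

text \<open>
  Compares \<open>F\<close> on the circle with a fixed value \<open>F w\<close> by the fundamental theorem, then applies the maximum
  modulus principle to \<open>F - F w\<close>; this elementary bound takes the place of Hardy's inequality.
\<close>

lemma cmod_diff_le_circle_integral:
  assumes F: "F holomorphic_on \<bbbD>" and r: "0 < r" "r < 1" and w: "cmod w \<le> r"
  shows "cmod (F w - F 0) \<le> r * integral {0..2 * pi} (\<lambda>\<theta>. cmod (deriv F (of_real r * cis \<theta>)))"
proof -
  define B where "B = r * integral {0..2 * pi} (\<lambda>\<theta>. cmod (deriv F (of_real r * cis \<theta>)))"
  have inD: "of_real r * cis \<theta> \<in> \<bbbD>" for \<theta>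
    using r by simp
  have F': "deriv F holomorphic_on \<bbbD>"
    by (intro holomorphic_intros F) auto
  have cont: "continuous_on S (\<lambda>\<theta>. deriv F (of_real r * cis \<theta>))" for S
    using inD by (intro continuous_on_compose2[OF holomorphic_on_imp_continuous_on[OF F']] continuous_intros) auto
  have cont': "continuous_on S (\<lambda>\<theta>. cmod (deriv F (of_real r * cis \<theta>) * (of_real r * (\<i> * cis \<theta>))))" for S
    by (intro continuous_intros cont)
  have B: "B = integral {0..2 * pi} (\<lambda>\<theta>. cmod (deriv F (of_real r * cis \<theta>) * (of_real r * (\<i> * cis \<theta>))))"
    using r by (simp add: B_def norm_mult)
  have le: "cmod (F (of_real r * cis \<beta>) - F (of_real r * cis \<alpha>)) \<le> B"
    if "0 \<le> \<alpha>" "\<alpha> \<le> \<beta>" "\<beta> \<le> 2 * pi" for \<alpha> \<beta>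
  proof -
    have "((\<lambda>\<theta>. deriv F (of_real r * cis \<theta>) * (of_real r * (\<i> * cis \<theta>))) has_integral
        F (of_real r * cis \<beta>) - F (of_real r * cis \<alpha>)) {\<alpha>..\<beta>}"
    proof (rule fundamental_theorem_of_calculus[OF \<open>\<alpha> \<le> \<beta>\<close>])
      fix \<theta>
      have "((\<lambda>\<theta>. of_real r * cis \<theta>) has_vector_derivative of_real r * (\<i> * cis \<theta>)) (at \<theta> within {\<alpha>..\<beta>})"
        by (auto intro!: derivative_eq_intros simp: has_vector_derivative_def scaleR_conv_of_real)
      from field_vector_diff_chain_within[OF this, of F "deriv F (of_real r * cis \<theta>)"]
      show "((\<lambda>\<theta>. F (of_real r * cis \<theta>)) has_vector_derivative
          deriv F (of_real r * cis \<theta>) * (of_real r * (\<i> * cis \<theta>))) (at \<theta> within {\<alpha>..\<beta>})"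
        using holomorphic_derivI[OF F open_ball inD] by (simp add: o_def mult_ac)
    qed
    then have "cmod (F (of_real r * cis \<beta>) - F (of_real r * cis \<alpha>))
        = cmod (integral {\<alpha>..\<beta>} (\<lambda>\<theta>. deriv F (of_real r * cis \<theta>) * (of_real r * (\<i> * cis \<theta>))))"
      by (simp add: integral_unique)
    also have "\<dots> \<le> integral {\<alpha>..\<beta>} (\<lambda>\<theta>. cmod (deriv F (of_real r * cis \<theta>) * (of_real r * (\<i> * cis \<theta>))))"
      by (intro Henstock_Kurzweil_Integration.integral_norm_bound_integral integrable_continuous_interval
        cont' continuous_intros cont) auto
    also have "\<dots> \<le> B"
      unfolding B using that
      by (intro integral_subset_le integrable_continuous_interval cont') auto
    finally show ?thesis .
  qed
  have polar: "\<exists>\<theta>. 0 \<le> \<theta> \<and> \<theta> \<le> 2 * pi \<and> z = of_real r * cis \<theta>" if "cmod z = r" for z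
    using Arg2pi_eq[of z] Arg2pi_ge_0[of z] Arg2pi_lt_2pi[of z] that
    by (intro exI[of _ "Arg2pi z"]) (auto simp: cis_conv_exp mult_ac)
  have osc: "cmod (F z - F v) \<le> B" if z: "cmod z = r" and v: "cmod v = r" for z v
  proof -
    obtain \<alpha> \<beta> where *: "0 \<le> \<alpha>" "\<alpha> \<le> 2 * pi" "z = of_real r * cis \<alpha>" "0 \<le> \<beta>" "\<beta> \<le> 2 * pi" "v = of_real r * cis \<beta>"
      using polar[OF z] polar[OF v] by blast
    show ?thesis
    proof (cases "\<alpha> \<le> \<beta>")
      case True
      then show ?thesis
        using le[of \<alpha> \<beta>] * by (simp add: norm_minus_commute)
    next
      case False
      then show ?thesis
        using le[of \<beta> \<alpha>] * by simp
    qed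
  qed
  have sub: "cball 0 r \<subseteq> \<bbbD>"
    using r by auto
  have max: "cmod (F z - c) \<le> B" if bd: "\<And>v. cmod v = r \<Longrightarrow> cmod (F v - c) \<le> B" and z: "cmod z \<le> r" for z c
  proof (rule maximum_modulus_frontier[where f = "\<lambda>z. F z - c" and S = "cball 0 r"])
    show "(\<lambda>z. F z - c) holomorphic_on interior (cball 0 r)"
      using sub interior_subset by (intro holomorphic_intros holomorphic_on_subset[OF F]) blast
    show "continuous_on (closure (cball 0 r)) (\<lambda>z. F z - c)"
      using sub by (simp add: continuous_intros holomorphic_on_imp_continuous_on[OF holomorphic_on_subset[OF F]])
    show "cmod (F v - c) \<le> B" if v: "v \<in> frontier (cball 0 r)" for v
    proof -
      have "frontier (cball 0 r) = sphere (0 :: complex) r"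
        by (rule frontier_cball)
      then show ?thesis
        using v by (intro bd) simp
    qed
  qed (use z in auto)
  \<comment> \<open>The maximum principle is used twice: with \<open>c = F v\<close> it carries the
    oscillation bound to the centre, and then with \<open>c = F 0\<close> to the point
    \<open>w\<close>.\<close>
  have "cmod (F v - F 0) \<le> B" if "cmod v = r" for v
    using max[of "F v" 0] osc that r by (simp add: norm_minus_commute)
  then show ?thesis
    using max[of "F 0" w] w by (simp add: B_def)
qed

lemma poly_bounded_on_disc:
  obtains M where "0 \<le> M" "\<And>z. z \<in> \<bbbD> \<Longrightarrow> cmod (poly q z) \<le> M"
proof -
  have "compact (poly q ` cball 0 1)"
    by (intro compact_continuous_image continuous_intros) auto
  then have "bounded (poly q ` cball 0 1)"
    by (rule compact_imp_bounded)
  then obtain M where M: "\<forall>x\<in>cball 0 1. cmod (poly q x) \<le> M"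
    unfolding bounded_iff by blast
  moreover have "cmod (poly q 0) \<le> M"
    using M by simp
  then have "0 \<le> M"
    by (rule order_trans[OF norm_ge_zero])
  ultimately show ?thesis
    using that[of M] by simp
qed

text \<open>Integration by parts reduces all polynomial symbols to the symbol \<open>z\<close>.\<close>

lemma poly_in_T_bounded:
  assumes hol: "\<And>f. f \<in> X \<Longrightarrow> f holomorphic_on \<bbbD>"
    and C: "\<And>f z. f \<in> X \<Longrightarrow> z \<in> \<bbbD> \<Longrightarrow> cmod (T_op (\<lambda>z. z) f z) \<le> C * N f"
  shows "poly q \<in> T_bounded X N"
proof -
  have deriv_poly: "deriv (poly p) z = poly (pderiv p) z" for p :: "complex poly" and z
    by (rule DERIV_imp_deriv[OF poly_DERIV])
  have pol: "poly p holomorphic_on \<bbbD>" for p :: "complex poly"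
    by (intro holomorphic_intros)
  have idh: "(\<lambda>z. z) holomorphic_on \<bbbD>"
    by (intro holomorphic_intros)
  obtain M1 where M1: "0 \<le> M1" "\<And>z. z \<in> \<bbbD> \<Longrightarrow> cmod (poly (pderiv q) z) \<le> M1"
    using poly_bounded_on_disc[of "pderiv q"] by blast
  obtain M2 where M2: "0 \<le> M2" "\<And>z. z \<in> \<bbbD> \<Longrightarrow> cmod (poly (pderiv (pderiv q)) z) \<le> M2"
    using poly_bounded_on_disc[of "pderiv (pderiv q)"] by blast
  have le: "cmod (T_op (poly q) f z) \<le> (M1 + M2) * C * N f" if f: "f \<in> X" and z: "z \<in> \<bbbD>" for f z
  proof -
    define F where "F = T_op (\<lambda>z. z) f"
    have F: "F holomorphic_on \<bbbD>"
      unfolding F_def by (rule T_op_holomorphic[OF hol[OF f] idh])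
    have dF: "(F has_field_derivative f w) (at w)" if "w \<in> \<bbbD>" for w
      using T_op_has_field_derivative[OF hol[OF f] idh that] by (simp add: F_def)
    have CN: "0 \<le> C * N f"
      using C[OF f, of 0] by simp
    have Fle: "cmod (F w) \<le> C * N f" if "w \<in> \<bbbD>" for w
      unfolding F_def by (rule C[OF f that])
    \<comment> \<open>\<open>G\<close> is the defect in the integration by parts formula; it has
      derivative 0 and vanishes at 0.\<close>
    define G where "G w = T_op (poly q) f w - (F w * poly (pderiv q) w - T_op (poly (pderiv q)) F w)" for w
    have "(G has_field_derivative 0) (at w within \<bbbD>)" if "w \<in> \<bbbD>" for w
    proof -
      have "(G has_field_derivative f w * poly (pderiv q) w
          - (f w * poly (pderiv q) w + poly (pderiv (pderiv q)) w * F w - F w * poly (pderiv (pderiv q)) w)) (at w)"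
        unfolding G_def
        by (intro DERIV_diff DERIV_mult dF that poly_DERIV
          T_op_has_field_derivative[OF hol[OF f] pol that, unfolded deriv_poly]
          T_op_has_field_derivative[OF F pol that, unfolded deriv_poly])
      then show ?thesis
        by (simp add: mult.commute has_field_derivative_at_within)
    qed
    then obtain c where c: "\<And>w. w \<in> \<bbbD> \<Longrightarrow> G w = c"
      using has_field_derivative_zero_constant[of "\<bbbD>" G] by auto
    have "G 0 = 0"
      by (simp add: G_def F_def)
    then have "G z = 0"
      using c[OF z] c[of 0] by simp
    then have "T_op (poly q) f z = F z * poly (pderiv q) z - T_op (poly (pderiv q)) F z"
      by (simp add: G_def)
    also have "cmod \<dots> \<le> C * N f * M1 + C * N f * M2"
    proof (intro norm_triangle_le_diff add_mono)
      show "cmod (F z * poly (pderiv q) z) \<le> C * N f * M1"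
        unfolding norm_mult by (intro mult_mono Fle M1 z CN) auto
      show "cmod (T_op (poly (pderiv q)) F z) \<le> C * N f * M2"
      proof (rule cmod_T_op_le[OF F pol z])
        show "0 \<le> C * N f * M2"
          using CN M2(1) by simp
        fix w assume "cmod w \<le> cmod z"
        then have "w \<in> \<bbbD>" using z by simp
        then show "cmod (F w * deriv (poly (pderiv q)) w) \<le> C * N f * M2"
          unfolding norm_mult deriv_poly by (intro mult_mono Fle M2 CN) auto
      qed
    qed
    finally show ?thesis
      by (simp add: algebra_simps)
  qed
  have T: "T_op (poly q) f holomorphic_on \<bbbD>" if "f \<in> X" for f
    by (rule T_op_holomorphic[OF hol[OF that] pol])
  show ?thesis
    unfolding T_bounded_def
  proof (intro CollectI conjI ballI exI)
    show "T_op (poly q) f \<in> Hinf" if "f \<in> X" for f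
      by (rule HinfI[OF T[OF that] le[OF that]])
    show "Hinf_norm (T_op (poly q) f) \<le> (M1 + M2) * C * N f" if "f \<in> X" for f
      by (rule Hinf_norm_le[OF T[OF that] le[OF that]])
  qed (rule pol)
qed

section \<open>The symbol \<open>z\<close> on the Hardy and Hardy-Littlewood spaces\<close>

text \<open>The derivative of \<open>T_op (\<lambda>z. z) f\<close> is \<open>f\<close>, so its
  oscillation is bounded by a circle integral of \<open>cmod (f z)\<close>. Any circle enclosing
  \<open>z\<close> will do, hence bounds for radii beyond some \<open>s < 1\<close> suffice; the
  Dirichlet case uses \<open>s = 1 / 2\<close>.\<close>

lemma cmod_T_op_id_le_circle_means:
  assumes f: "f holomorphic_on \<bbbD>" and s: "s < 1"
    and B: "\<And>r. s < r \<Longrightarrow> 0 < r \<Longrightarrow> r < 1 \<Longrightarrow> integral {0..2 * pi} (\<lambda>\<theta>. cmod (f (of_real r * cis \<theta>))) \<le> B"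
    and z: "z \<in> \<bbbD>"
  shows "cmod (T_op (\<lambda>z. z) f z) \<le> B"
proof -
  have idh: "(\<lambda>z. z) holomorphic_on \<bbbD>"
    by (intro holomorphic_intros)
  have d: "deriv (T_op (\<lambda>z. z) f) w = f w" if "w \<in> \<bbbD>" for w
    using T_op_has_field_derivative[OF f idh that] by (simp add: DERIV_imp_deriv)
  have "max (max s 0) (cmod z) < 1"
    using s z by auto
  then obtain r where r: "max (max s 0) (cmod z) < r" "r < 1"
    using dense by blast
  have inD: "of_real r * cis \<theta> \<in> \<bbbD>" for \<theta>
    using r by simp
  have "cmod (T_op (\<lambda>z. z) f z - T_op (\<lambda>z. z) f 0)
      \<le> r * integral {0..2 * pi} (\<lambda>\<theta>. cmod (deriv (T_op (\<lambda>z. z) f) (of_real r * cis \<theta>)))"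
    using r by (intro cmod_diff_le_circle_integral T_op_holomorphic f idh) auto
  also have "\<dots> = r * integral {0..2 * pi} (\<lambda>\<theta>. cmod (f (of_real r * cis \<theta>)))"
    by (simp only: d[OF inD])
  also have "\<dots> \<le> 1 * integral {0..2 * pi} (\<lambda>\<theta>. cmod (f (of_real r * cis \<theta>)))"
  proof (rule mult_right_mono)
    show "0 \<le> integral {0..2 * pi} (\<lambda>\<theta>. cmod (f (of_real r * cis \<theta>)))"
      using inD by (intro Henstock_Kurzweil_Integration.integral_nonneg integrable_continuous_interval continuous_intros
        continuous_on_compose2[OF holomorphic_on_imp_continuous_on[OF f]]) auto
  qed (use r in simp)
  also have "\<dots> \<le> B"
    using B[of r] r by simp
  finally show ?thesis by simp
qed

lemma hardy_T_op_id:
  assumes f: "f \<in> hardy_space 1" and z: "z \<in> \<bbbD>"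
  shows "cmod (T_op (\<lambda>z. z) f z) \<le> 2 * pi * hardy_norm 1 f"
proof (rule cmod_T_op_id_le_circle_means[where s = 0])
  show hol: "f holomorphic_on \<bbbD>"
    using f by (simp add: hardy_space_def)
  fix r :: real assume r: "0 < r" "r < 1"
  \<comment> \<open>Removing the outer \<open>powr 1\<close> from \<open>hardy_mean\<close> requires
    a nonnegative base.\<close>
  have "0 \<le> integral {0..2 * pi} (\<lambda>\<theta>. cmod (f (of_real r * cis \<theta>)))"
    using r by (intro Henstock_Kurzweil_Integration.integral_nonneg integrable_continuous_interval continuous_intros
      continuous_on_compose2[OF holomorphic_on_imp_continuous_on[OF hol]]) auto
  then have "integral {0..2 * pi} (\<lambda>\<theta>. cmod (f (of_real r * cis \<theta>))) = 2 * pi * hardy_mean 1 r f"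
    by (simp add: hardy_mean_def)
  also have "\<dots> \<le> 2 * pi * hardy_norm 1 f"
    using hardy_mean_le_hardy_norm[OF f r] by (intro mult_left_mono) auto
  finally show "integral {0..2 * pi} (\<lambda>\<theta>. cmod (f (of_real r * cis \<theta>))) \<le> 2 * pi * hardy_norm 1 f" .
qed (use z in auto)

text \<open>Integration shifts the Taylor coefficients and divides them by \<open>n + 1\<close>. The
  norm for \<open>p = 1\<close> is precisely the sum of the moduli of these new coefficients, and it
  dominates the power series on the disc.\<close>

lemma HL_T_op_id:
  assumes f: "f \<in> HL_space 1" and z: "z \<in> \<bbbD>"
  shows "cmod (T_op (\<lambda>z. z) f z) \<le> HL_norm 1 f"
proof -
  have hol: "f holomorphic_on \<bbbD>"
    using f by (simp add: HL_space_def)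
  have idh: "(\<lambda>z. z) holomorphic_on \<bbbD>"
    by (intro holomorphic_intros)
  define F where "F = T_op (\<lambda>z. z) f"
  have F: "F holomorphic_on \<bbbD>"
    unfolding F_def by (rule T_op_holomorphic[OF hol idh])
  have dF: "deriv F w = f w" if "w \<in> \<bbbD>" for w
    using T_op_has_field_derivative[OF hol idh that] by (simp add: F_def DERIV_imp_deriv)
  define c where "c n = cmod (maclaurin_coeff f n) * (1 / real (n + 1))" for n
  have eq: "cmod (maclaurin_coeff f n) powr 1 * real (n + 1) powr (1 - 2) = c n" for n
    by (simp add: c_def powr_minus_divide)
  have c: "summable c" "HL_norm 1 f = (\<Sum>n. c n)"
    using f suminf_nonneg[of c] by (auto simp: HL_space_def HL_norm_def eq c_def[abs_def])
  have coeff: "(deriv ^^ Suc n) F 0 = (deriv ^^ n) f 0" for n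
  proof -
    have "(deriv ^^ n) (deriv F) 0 = (deriv ^^ n) f 0"
      by (rule higher_deriv_transform_within_open[OF _ hol open_ball]) (auto intro!: holomorphic_intros F dF)
    then show ?thesis
      by (simp only: funpow_Suc_right o_apply)
  qed
  define b where "b n = (deriv ^^ n) F 0 / fact n * z ^ n" for n
  have "b sums F z"
    using holomorphic_power_series[OF F z] by (simp add: b_def[abs_def])
  moreover have "b 0 = 0"
    by (simp add: b_def F_def)
  ultimately have b: "(\<lambda>n. b (Suc n)) sums F z"
    by (simp add: sums_Suc_iff)
  have bc: "cmod (b (Suc n)) \<le> c n" for n
  proof -
    have "cmod (b (Suc n)) = c n * cmod z ^ Suc n"
      unfolding b_def coeff c_def maclaurin_coeff_def
      by (simp add: norm_mult norm_divide norm_power del: power_Suc of_nat_Suc of_nat_add)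
    also have "\<dots> \<le> c n * 1"
      using z by (intro mult_left_mono power_le_one) (auto simp: c_def)
    finally show ?thesis by simp
  qed
  have "cmod (F z) = cmod (\<Sum>n. b (Suc n))"
    using b by (simp add: sums_iff)
  also have "\<dots> \<le> (\<Sum>n. c n)"
    by (rule norm_suminf_le[OF bc c(1)])
  finally show ?thesis
    by (simp add: c F_def)
qed

subsection \<open>Dirichlet-type spaces\<close>

lemma nn_integral_circle:
  assumes "continuous_on {0..2 * pi} h" "\<And>\<theta>. 0 \<le> h \<theta>"
  shows "(\<integral>\<^sup>+\<theta>. ennreal (h \<theta>) * indicator {0..2 * pi} \<theta> \<partial>lborel) = ennreal (integral {0..2 * pi} h)"
  using assms by (intro nn_integral_has_integral_lebesgue' integrable_integral integrable_continuous_interval)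

text \<open>Extending by 0 outside the disc allows integration over the whole plane, as polar
  coordinates require.\<close>

definition dirichlet_integrand :: "real \<Rightarrow> (complex \<Rightarrow> complex) \<Rightarrow> complex \<Rightarrow> real"
  where "dirichlet_integrand p f z = indicator \<bbbD> z *\<^sub>R (cmod (deriv f z) powr p * (1 - cmod z) powr (p - 1))"

lemma dirichlet_integrand_nonneg [simp]: "0 \<le> dirichlet_integrand p f z"
  by (simp add: dirichlet_integrand_def)

lemma dirichlet_integrand_measurable:
  assumes f: "f holomorphic_on \<bbbD>" and p: "0 < p"
  shows "dirichlet_integrand p f \<in> borel_measurable borel"
proof -
  have "deriv f holomorphic_on \<bbbD>"
    by (intro holomorphic_intros f) auto
  then have "continuous_on \<bbbD> (\<lambda>z. cmod (deriv f z) powr p * (1 - cmod z) powr (p - 1))"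
    using p by (intro continuous_intros continuous_on_powr' holomorphic_on_imp_continuous_on) auto
  then show ?thesis
    unfolding dirichlet_integrand_def[abs_def] by (intro borel_measurable_continuous_on_indicator) auto
qed

lemma dirichlet_space_iff:
  "f \<in> dirichlet_space p \<longleftrightarrow> f holomorphic_on \<bbbD> \<and> integrable lborel (dirichlet_integrand p f)"
  by (simp add: dirichlet_space_def set_integrable_def dirichlet_integrand_def[abs_def])

lemma dirichlet_norm_eq:
  "dirichlet_norm p f = (1 / pi * (LINT z|lborel. dirichlet_integrand p f z) + cmod (f 0) powr p) powr (1 / p)"
  by (simp add: dirichlet_norm_def set_lebesgue_integral_def dirichlet_integrand_def[abs_def])

section \<open>Test functions in the Dirichlet-type spaces\<close>

text \<open>The integrand is the derivative of \<open>G\<close>, which is \<open>- 1 / p\<close>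
  times the \<open>p\<close>-th power of \<open>(1 - r) / (d + (1 - r))\<close>. That quotient lies
  between 0 and 1, so the bound is independent of \<open>d\<close>.\<close>

lemma radial_integral_le:
  fixes p d :: real
  assumes p: "0 < p" and d: "0 < d"
  shows "(\<integral>\<^sup>+r. ennreal (d * (1 - r) powr (p - 1) * (d + (1 - r)) powr (- (p + 1))) * indicator {0..1} r \<partial>lborel)
    \<le> ennreal (1 / p)"
proof -
  define G where "G r = - ((1 - r) powr p * (d + (1 - r)) powr (- p)) / p" for r
  have "((\<lambda>r. d * (1 - r) powr (p - 1) * (d + (1 - r)) powr (- (p + 1))) has_integral G 1 - G 0) {0..1}"
  \<comment> \<open>For \<open>p < 1\<close> differentiability of \<open>G\<close> fails at
    \<open>r = 1\<close>, so derivatives are taken in the open interval and continuity covers the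
    ends.\<close>
  proof (rule fundamental_theorem_of_calculus_interior)
    show "continuous_on {0..1} G"
      unfolding G_def using p d by (intro continuous_intros continuous_on_powr') auto
    fix r :: real assume "r \<in> {0<..<1}"
    then have r: "0 < 1 - r" by simp
    define t where "t = 1 - r"
    have t: "0 < t" "0 < d + t" using r d by (auto simp: t_def)
    have "(G has_real_derivative - ((- (p * t powr (p - 1))) * (d + t) powr (- p)
        + - (- p * (d + t) powr (- p - 1)) * t powr p) / p) (at r)"
      unfolding G_def t_def using r d p t(2)[unfolded t_def]
      by (auto intro!: derivative_eq_intros simp: diff_divide_distrib)
    also have "- ((- (p * t powr (p - 1))) * (d + t) powr (- p)
        + - (- p * (d + t) powr (- p - 1)) * t powr p) / p
        = t powr (p - 1) * (d + t) powr (- p) - t powr p * (d + t) powr (- p - 1)"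
      using p by (simp add: field_simps)
    also have "\<dots> = d * t powr (p - 1) * (d + t) powr (- (p + 1))"
    proof -
      have "t powr p = t powr (p - 1) * t" "(d + t) powr (- p) = (d + t) powr (- (p + 1)) * (d + t)" "- p - 1 = - (p + 1)"
        using t powr_add[of t "p - 1" 1] powr_add[of "d + t" "- (p + 1)" 1] by simp_all
      then show ?thesis
        by (simp only:) (simp add: algebra_simps)
    qed
    finally show "(G has_vector_derivative d * (1 - r) powr (p - 1) * (d + (1 - r)) powr (- (p + 1))) (at r)"
      by (simp add: t_def has_real_derivative_iff_has_vector_derivative)
  qed simp
  then have "(\<integral>\<^sup>+r. ennreal (d * (1 - r) powr (p - 1) * (d + (1 - r)) powr (- (p + 1))) * indicator {0..1} r \<partial>lborel)
      = ennreal (G 1 - G 0)"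
    using d by (intro nn_integral_has_integral_lebesgue') auto
  also have "G 1 - G 0 \<le> 1 / p"
  proof -
    have "(d + 1) powr (- p) \<le> 1"
      using p d powr_mono[of "- p" 0 "d + 1"] by simp
    then show ?thesis
      using p by (simp add: G_def divide_right_mono)
  qed
  finally show ?thesis by (simp add: ennreal_leI)
qed

text \<open>The logarithmic derivative of the test function is
  \<open>k * cnj a / (1 - cnj a * z)\<close>. Its size is estimated radially, so the angle enters
  only through the squared denominator, ready for the Poisson integral.\<close>

lemma dirichlet_integrand_test_fun_le:
  assumes a: "a \<in> \<bbbD>" and z: "z \<in> \<bbbD>" and p: "0 < p" and k: "2 \<le> real k * p"
  shows "dirichlet_integrand p (test_fun p k a) z
    \<le> real k powr p * (1 - cmod a) * (1 - cmod a * cmod z) powr (- p) * (1 - cmod z) powr (p - 1) * (1 / (cmod (1 - cnj a * z))\<^sup>2)"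
proof -
  define u where "u = cmod (1 - cnj a * z)"
  note u = one_minus_cnj_mult[OF a z, folded u_def]
  have u0: "0 < u" using u by linarith
  have "deriv (test_fun p k a) z = test_fun p k a z * (of_nat k * cnj a / (1 - cnj a * z))"
    using higher_deriv_test_fun[OF a z, of 1 p k] by (simp add: test_fun_def field_simps)
  then have "cmod (deriv (test_fun p k a) z) = cmod (test_fun p k a z) * (real k * cmod a / u)"
    by (simp add: norm_mult norm_divide u_def)
  also have "\<dots> \<le> cmod (test_fun p k a z) * (real k / (1 - cmod a * cmod z))"
    using a u u0 by (intro mult_left_mono frac_le) (auto simp: mult_left_le)
  finally have "cmod (deriv (test_fun p k a) z) powr p \<le> (cmod (test_fun p k a z) * (real k / (1 - cmod a * cmod z))) powr p"
    using p by (intro powr_mono2) auto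
  also have "\<dots> = cmod (test_fun p k a z) powr p * (real k powr p * (1 - cmod a * cmod z) powr (- p))"
    using u by (simp add: powr_mult powr_divide powr_minus_divide)
  also have "\<dots> \<le> (1 - cmod a) / u\<^sup>2 * (real k powr p * (1 - cmod a * cmod z) powr (- p))"
    unfolding u_def using test_fun_powr_le[OF a z p k] by (intro mult_right_mono) auto
  finally have "cmod (deriv (test_fun p k a) z) powr p * (1 - cmod z) powr (p - 1)
      \<le> (1 - cmod a) / u\<^sup>2 * (real k powr p * (1 - cmod a * cmod z) powr (- p)) * (1 - cmod z) powr (p - 1)"
    by (rule mult_right_mono) simp
  then show ?thesis
    using z by (simp add: dirichlet_integrand_def u_def mult_ac)
qed

lemma nn_integral_dirichlet_test_fun_le:
  assumes a: "a \<in> \<bbbD>" and p: "0 < p" and k: "2 \<le> real k * p"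
  shows "(\<integral>\<^sup>+z. ennreal (dirichlet_integrand p (test_fun p k a) z) \<partial>lborel)
    \<le> ennreal (2 * pi * real k powr p * 2 powr (p + 1) / p)"
proof -
  define d M where "d = 1 - cmod a" and "M = 2 * pi * real k powr p * 2 powr (p + 1)"
  have d: "0 < d" using a by (simp add: d_def)
  have M: "0 \<le> M" by (simp add: M_def)
  have [measurable]: "dirichlet_integrand p (test_fun p k a) \<in> borel_measurable borel"
    by (rule dirichlet_integrand_measurable[OF test_fun_holomorphic[OF a] p])
  have inner: "ennreal r * (\<integral>\<^sup>+\<theta>. ennreal (dirichlet_integrand p (test_fun p k a) (of_real r * cis \<theta>)) * indicator {0..2 * pi} \<theta> \<partial>lborel)
      \<le> ennreal M * (ennreal (d * (1 - r) powr (p - 1) * (d + (1 - r)) powr (- (p + 1))) * indicator {0..1} r)"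
    (is "_ * ?I \<le> ?rhs") for r :: real
  proof (cases "0 < r \<and> r < 1")
    case False
    then consider "r \<le> 0" | "1 \<le> r" by linarith
    then show ?thesis
    proof cases
      case 1
      then show ?thesis by (simp add: ennreal_neg)
    next
      case 2
      then have "dirichlet_integrand p (test_fun p k a) (of_real r * cis \<theta>) = 0" for \<theta>
        by (simp add: dirichlet_integrand_def)
      then show ?thesis by simp
    qed
  next
    case True
    then have r: "0 < r" "r < 1" by auto
    have inD: "of_real r * cis \<theta> \<in> \<bbbD>" for \<theta>
      using r by simp
    have rD: "of_real r \<in> \<bbbD>" using r by simp
    \<comment> \<open>The Poisson integral contributes
      \<open>2 * pi / (1 - (1 - q)\<^sup>2)\<close>, which is at most \<open>2 * pi / q\<close>
      since \<open>q \<le> 1\<close>.\<close>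
    define q where "q = 1 - cmod a * r"
    have q: "0 < q" "d \<le> q" "1 - r \<le> q"
      using one_minus_cnj_mult(2-4)[OF a rD] r by (simp_all add: d_def q_def)
    have q1: "q \<le> 1" using r by (simp add: q_def)
    have b: "cnj a * of_real r \<in> \<bbbD>"
      using q(1) r by (simp add: norm_mult q_def)
    define c where "c = real k powr p * d * q powr (- p) * (1 - r) powr (p - 1)"
    have c: "0 \<le> c" using d by (simp add: c_def)
    have "?I \<le> (\<integral>\<^sup>+\<theta>. ennreal (c * (1 / (cmod (1 - cnj a * of_real r * cis \<theta>))\<^sup>2)) * indicator {0..2 * pi} \<theta> \<partial>lborel)"
      using dirichlet_integrand_test_fun_le[OF a inD p k] r
      by (intro nn_integral_mono mult_right_mono ennreal_leI) (auto simp: c_def d_def q_def mult.assoc)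
    also have "\<dots> = ennreal (c * (2 * pi / (1 - (cmod (cnj a * of_real r))\<^sup>2)))"
      using c by (intro nn_integral_has_integral_lebesgue' has_integral_mult_right poisson_integral b) auto
    also have "(cmod (cnj a * of_real r))\<^sup>2 = (1 - q)\<^sup>2"
      using r by (simp add: norm_mult q_def)
    also have "ennreal (c * (2 * pi / (1 - (1 - q)\<^sup>2))) \<le> ennreal (c * (2 * pi / q))"
    proof (intro ennreal_leI mult_left_mono c divide_left_mono)
      have "q * 1 \<le> q * (2 - q)"
        using q q1 by (intro mult_left_mono) auto
      then show le: "q \<le> 1 - (1 - q)\<^sup>2"
        by (simp add: power2_eq_square algebra_simps)
      show "0 < (1 - (1 - q)\<^sup>2) * q"
        using q le by (intro mult_pos_pos) auto
    qed simp
    finally have I: "?I \<le> ennreal (c * (2 * pi / q))" .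
    have "q powr (- p) / q = q powr (- (p + 1))"
      using q powr_diff[of q "- p" 1] by simp
    \<comment> \<open>\<open>q\<close> is at least both \<open>d\<close> and \<open>1 - r\<close>,
      hence at least their average; the halving produces the constant
      \<open>2 powr (p + 1)\<close>.\<close>
    also have "\<dots> \<le> ((d + (1 - r)) / 2) powr (- (p + 1))"
      using d r q p by (intro powr_mono2') auto
    also have "\<dots> = (d + (1 - r)) powr (- (p + 1)) * 2 powr (p + 1)"
    proof -
      have half: "(x / 2) powr (- e) = x powr (- e) * 2 powr e" if "0 \<le> x" for x e :: real
        using that by (simp add: powr_divide powr_minus field_simps)
      show ?thesis
        by (rule half) (use d r in simp)
    qed
    finally have qle: "q powr (- p) / q \<le> (d + (1 - r)) powr (- (p + 1)) * 2 powr (p + 1)" .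
    have "ennreal r * ?I \<le> 1 * ?I"
      using r by (intro mult_right_mono) auto
    also have "\<dots> \<le> ennreal (2 * pi * real k powr p * d * (1 - r) powr (p - 1) * (q powr (- p) / q))"
      using I by (simp add: c_def mult_ac)
    also have "\<dots> \<le> ennreal (2 * pi * real k powr p * d * (1 - r) powr (p - 1) * ((d + (1 - r)) powr (- (p + 1)) * 2 powr (p + 1)))"
      using d by (intro ennreal_leI mult_left_mono qle) auto
    also have "\<dots> = ?rhs"
      using r M d by (simp add: ennreal_mult[symmetric] M_def mult_ac)
    finally show ?thesis .
  qed
  have "(\<integral>\<^sup>+z. ennreal (dirichlet_integrand p (test_fun p k a) z) \<partial>lborel)
    \<le> (\<integral>\<^sup>+r. ennreal M * (ennreal (d * (1 - r) powr (p - 1) * (d + (1 - r)) powr (- (p + 1))) * indicator {0..1} r) \<partial>lborel)"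
    by (subst nn_integral_polar) (simp, intro nn_integral_mono inner)
  also have "\<dots> = ennreal M * (\<integral>\<^sup>+r. ennreal (d * (1 - r) powr (p - 1) * (d + (1 - r)) powr (- (p + 1))) * indicator {0..1} r \<partial>lborel)"
    by (rule nn_integral_cmult) simp
  also have "\<dots> \<le> ennreal M * ennreal (1 / p)"
    by (intro mult_left_mono radial_integral_le p d) simp
  also have "\<dots> = ennreal (M / p)"
    using M p by (simp add: ennreal_mult[symmetric])
  finally show ?thesis by (simp add: M_def)
qed

lemma test_fun_dirichlet:
  assumes a: "a \<in> \<bbbD>" and p: "0 < p" and k: "2 \<le> real k * p"
  shows "test_fun p k a \<in> dirichlet_space p" "0 \<le> dirichlet_norm p (test_fun p k a)"
    "dirichlet_norm p (test_fun p k a) \<le> (1 / pi * (2 * pi * real k powr p * 2 powr (p + 1) / p) + 1) powr (1 / p)"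
proof -
  let ?w = "dirichlet_integrand p (test_fun p k a)" and ?M = "2 * pi * real k powr p * 2 powr (p + 1) / p"
  have meas: "?w \<in> borel_measurable lborel"
    using dirichlet_integrand_measurable[OF test_fun_holomorphic[OF a] p] by simp
  note le = nn_integral_dirichlet_test_fun_le[OF a p k]
  have int: "integrable lborel ?w"
    by (rule integrableI_nonneg[OF meas]) (use le in \<open>auto intro: le_less_trans\<close>)
  then show "test_fun p k a \<in> dirichlet_space p"
    using test_fun_holomorphic[OF a] by (simp add: dirichlet_space_iff)
  show "0 \<le> dirichlet_norm p (test_fun p k a)"
    by (simp add: dirichlet_norm_def)
  have "ennreal (LINT z|lborel. ?w z) \<le> ennreal ?M"
    using le nn_integral_eq_integral[OF int] by simp
  then have L: "(LINT z|lborel. ?w z) \<le> ?M"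
    using p by (subst (asm) ennreal_le_iff) auto
  have "cmod (test_fun p k a 0) = (1 - cmod a) powr (real k - 1 / p)"
    by (simp add: test_fun_def)
  also have "\<dots> \<le> 1"
  proof (rule powr_le1)
    show "0 \<le> real k - 1 / p" using p k by (simp add: field_simps)
  qed (use a in auto)
  finally have "cmod (test_fun p k a 0) powr p \<le> 1"
    using p by (intro powr_le1) auto
  then show "dirichlet_norm p (test_fun p k a) \<le> (1 / pi * ?M + 1) powr (1 / p)"
    unfolding dirichlet_norm_eq using p L
    by (intro powr_mono2 add_mono mult_left_mono) (auto intro!: add_nonneg_nonneg Bochner_Integration.integral_nonneg)
qed

section \<open>The symbol \<open>z\<close> on the Dirichlet-type space\<close>

text \<open>The circle means of \<open>f\<close> are bounded in two stages: averaging the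
  oscillation estimate over radii controls \<open>f\<close> up to modulus \<open>1 / 2\<close>, and
  integrating \<open>deriv f\<close> along rays controls it beyond. Starting the rays at
  \<open>1 / 2\<close> keeps the polar weight away from 0.\<close>

lemma dirichlet_T_op_id:
  assumes f: "f \<in> dirichlet_space 1" and z: "z \<in> \<bbbD>"
  shows "cmod (T_op (\<lambda>z. z) f z) \<le> (4 * pi\<^sup>2 + 2 * pi) * dirichlet_norm 1 f"
proof -
  let ?w = "dirichlet_integrand 1 f"
  have hol: "f holomorphic_on \<bbbD>" and int: "integrable lborel ?w"
    using f by (auto simp: dirichlet_space_iff)
  have [measurable]: "?w \<in> borel_measurable borel"
    by (rule dirichlet_integrand_measurable[OF hol]) simp
  have [measurable]: "cis \<in> borel_measurable borel"
    by (intro borel_measurable_continuous_onI continuous_intros)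
  have hol': "deriv f holomorphic_on \<bbbD>"
    by (intro holomorphic_intros hol) auto
  note cont = holomorphic_on_imp_continuous_on[OF hol] and cont' = holomorphic_on_imp_continuous_on[OF hol']
  define I where "I = (LINT z|lborel. ?w z)"
  have I0: "0 \<le> I" by (simp add: I_def)
  have w: "?w v = cmod (deriv f v)" if "v \<in> \<bbbD>" for v
    using that by (simp add: dirichlet_integrand_def)
  have nnI: "(\<integral>\<^sup>+v. ennreal (?w v) \<partial>lborel) = ennreal I"
    unfolding I_def by (rule nn_integral_eq_integral[OF int]) simp
  have I_polar: "(\<integral>\<^sup>+r. ennreal r * (\<integral>\<^sup>+\<theta>. ennreal (?w (of_real r * cis \<theta>)) * indicator {0..2 * pi} \<theta> \<partial>lborel) \<partial>lborel) = ennreal I"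
    unfolding nnI[symmetric] by (rule nn_integral_polar[symmetric]) simp
  have small: "cmod (f v) \<le> cmod (f 0) + 2 * I" if v: "cmod v \<le> 1 / 2" for v
  proof -
    \<comment> \<open>The denominator 2 comes from the length of the interval of radii between
      \<open>1 / 2\<close> and 1, all of whose circles enclose \<open>v\<close>.\<close>
    have "ennreal (cmod (f v - f 0) / 2) = (\<integral>\<^sup>+r. ennreal (cmod (f v - f 0)) * indicator {1 / 2<..<1} r \<partial>(lborel :: real measure))"
      using ennreal_mult[of "cmod (f v - f 0)" "1 / 2"] by (subst nn_integral_cmult_indicator) auto
    also have "\<dots> \<le> (\<integral>\<^sup>+r. ennreal r * (\<integral>\<^sup>+\<theta>. ennreal (?w (of_real r * cis \<theta>)) * indicator {0..2 * pi} \<theta> \<partial>lborel) \<partial>lborel)"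
    proof (rule nn_integral_mono)
      fix r :: real
      show "ennreal (cmod (f v - f 0)) * indicator {1 / 2<..<1} r
          \<le> ennreal r * (\<integral>\<^sup>+\<theta>. ennreal (?w (of_real r * cis \<theta>)) * indicator {0..2 * pi} \<theta> \<partial>lborel)"
      proof (cases "r \<in> {1 / 2<..<1}")
        case True
        then have r: "0 < r" "r < 1" by auto
        have inD: "of_real r * cis \<theta> \<in> \<bbbD>" for \<theta>
          using r by simp
        have "cmod (f v - f 0) \<le> r * integral {0..2 * pi} (\<lambda>\<theta>. cmod (deriv f (of_real r * cis \<theta>)))"
          using True v by (intro cmod_diff_le_circle_integral hol r) auto
        then have "ennreal (cmod (f v - f 0)) \<le> ennreal r * ennreal (integral {0..2 * pi} (\<lambda>\<theta>. cmod (deriv f (of_real r * cis \<theta>))))"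
          using r by (simp add: ennreal_leI ennreal_mult'[symmetric])
        also have "ennreal (integral {0..2 * pi} (\<lambda>\<theta>. cmod (deriv f (of_real r * cis \<theta>))))
            = (\<integral>\<^sup>+\<theta>. ennreal (cmod (deriv f (of_real r * cis \<theta>))) * indicator {0..2 * pi} \<theta> \<partial>lborel)"
          using inD by (intro nn_integral_circle[symmetric] continuous_intros continuous_on_compose2[OF cont']) auto
        also have "\<dots> = (\<integral>\<^sup>+\<theta>. ennreal (?w (of_real r * cis \<theta>)) * indicator {0..2 * pi} \<theta> \<partial>lborel)"
          by (simp only: w[OF inD])
        finally show ?thesis
          using True by simp
      qed simp
    qed
    also have "\<dots> = ennreal I" by (rule I_polar)
    finally have "cmod (f v - f 0) / 2 \<le> I"
      using I0 by (subst (asm) ennreal_le_iff) auto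
    then show ?thesis
      using norm_triangle_sub[of "f v" "f 0"] by linarith
  qed
  define B where "B = cmod (f 0) + 2 * I"
  have B0: "0 \<le> B" using I0 by (simp add: B_def)
  have large: "integral {0..2 * pi} (\<lambda>\<theta>. cmod (f (of_real r * cis \<theta>))) \<le> 2 * pi * B + 2 * I"
    if r: "1 / 2 < r" "r < 1" for r
  proof -
    have ray: "ennreal (cmod (f (of_real r * cis \<theta>)))
        \<le> ennreal B + 2 * (\<integral>\<^sup>+s. ennreal s * ennreal (?w (of_real s * cis \<theta>)) \<partial>lborel)" for \<theta>
    proof -
      have inD: "of_real s * cis \<theta> \<in> \<bbbD>" if "s \<in> {1 / 2..r}" for s
        using that r by simp
      have c: "continuous_on {1 / 2..r} (\<lambda>s. deriv f (of_real s * cis \<theta>))"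
        using inD by (intro continuous_on_compose2[OF cont'] continuous_intros) auto
      have "((\<lambda>s. deriv f (of_real s * cis \<theta>) * cis \<theta>) has_integral
          f (of_real r * cis \<theta>) - f (of_real (1 / 2) * cis \<theta>)) {1 / 2..r}"
      proof (rule fundamental_theorem_of_calculus)
        fix s assume s: "s \<in> {1 / 2..r}"
        have "((\<lambda>s. of_real s * cis \<theta>) has_vector_derivative cis \<theta>) (at s within {1 / 2..r})"
          by (auto intro!: derivative_eq_intros simp: has_vector_derivative_def scaleR_conv_of_real)
        from field_vector_diff_chain_within[OF this, of f "deriv f (of_real s * cis \<theta>)"]
        show "((\<lambda>s. f (of_real s * cis \<theta>)) has_vector_derivative deriv f (of_real s * cis \<theta>) * cis \<theta>) (at s within {1 / 2..r})"
          using holomorphic_derivI[OF hol open_ball inD[OF s]] by (simp add: o_def mult_ac)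
      qed (use r in simp)
      then have "cmod (f (of_real r * cis \<theta>) - f (of_real (1 / 2) * cis \<theta>))
          = cmod (integral {1 / 2..r} (\<lambda>s. deriv f (of_real s * cis \<theta>) * cis \<theta>))"
        by (simp only: integral_unique)
      also have "\<dots> \<le> integral {1 / 2..r} (\<lambda>s. cmod (deriv f (of_real s * cis \<theta>)))"
        by (intro Henstock_Kurzweil_Integration.integral_norm_bound_integral integrable_continuous_interval
          continuous_intros c) (simp add: norm_mult)
      finally have "cmod (f (of_real r * cis \<theta>)) \<le> B + integral {1 / 2..r} (\<lambda>s. cmod (deriv f (of_real s * cis \<theta>)))"
        using norm_triangle_sub[of "f (of_real r * cis \<theta>)" "f (of_real (1 / 2) * cis \<theta>)"]
          small[of "of_real (1 / 2) * cis \<theta>"] unfolding B_def cmod_of_real_cis by linarith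
      then have "ennreal (cmod (f (of_real r * cis \<theta>))) \<le> ennreal B + ennreal (integral {1 / 2..r} (\<lambda>s. cmod (deriv f (of_real s * cis \<theta>))))"
        using B0 c by (subst ennreal_plus[symmetric])
          (auto intro!: ennreal_leI Henstock_Kurzweil_Integration.integral_nonneg integrable_continuous_interval continuous_intros)
      also have "ennreal (integral {1 / 2..r} (\<lambda>s. cmod (deriv f (of_real s * cis \<theta>))))
          = (\<integral>\<^sup>+s. ennreal (cmod (deriv f (of_real s * cis \<theta>))) * indicator {1 / 2..r} s \<partial>lborel)"
        by (intro nn_integral_has_integral_lebesgue'[symmetric] integrable_integral integrable_continuous_interval continuous_intros c) auto
      also have "\<dots> \<le> (\<integral>\<^sup>+s. 2 * (ennreal s * ennreal (?w (of_real s * cis \<theta>))) \<partial>lborel)"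
      proof (rule nn_integral_mono)
        fix s :: real
        show "ennreal (cmod (deriv f (of_real s * cis \<theta>))) * indicator {1 / 2..r} s \<le> 2 * (ennreal s * ennreal (?w (of_real s * cis \<theta>)))"
        proof (cases "s \<in> {1 / 2..r}")
          case True
          \<comment> \<open>Since \<open>s \<ge> 1 / 2\<close>, the factor \<open>2 * s\<close> is
            at least 1, and this inserts the weight of polar coordinates.\<close>
          have "1 * cmod (deriv f (of_real s * cis \<theta>)) \<le> (2 * s) * cmod (deriv f (of_real s * cis \<theta>))"
            using True by (intro mult_right_mono) auto
          then have "ennreal (cmod (deriv f (of_real s * cis \<theta>))) \<le> ennreal (2 * s * cmod (deriv f (of_real s * cis \<theta>)))"
            by (intro ennreal_leI) simp
          also have "\<dots> = 2 * (ennreal s * ennreal (?w (of_real s * cis \<theta>)))"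
            using True by (simp add: w[OF inD[OF True]] ennreal_mult mult.assoc)
          finally show ?thesis using True by simp
        qed simp
      qed
      also have "\<dots> = 2 * (\<integral>\<^sup>+s. ennreal s * ennreal (?w (of_real s * cis \<theta>)) \<partial>lborel)"
        by (rule nn_integral_cmult) simp
      finally show ?thesis by (simp add: add_left_mono)
    qed
    have inD: "of_real r * cis \<theta> \<in> \<bbbD>" for \<theta>
      using r by simp
    have "ennreal (integral {0..2 * pi} (\<lambda>\<theta>. cmod (f (of_real r * cis \<theta>))))
        = (\<integral>\<^sup>+\<theta>. ennreal (cmod (f (of_real r * cis \<theta>))) * indicator {0..2 * pi} \<theta> \<partial>lborel)"
      using inD by (intro nn_integral_circle[symmetric] continuous_intros continuous_on_compose2[OF cont]) auto
    also have "\<dots> \<le> (\<integral>\<^sup>+\<theta>. (ennreal B + 2 * (\<integral>\<^sup>+s. ennreal s * ennreal (?w (of_real s * cis \<theta>)) \<partial>lborel)) * indicator {0..2 * pi} \<theta> \<partial>lborel)"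
      by (intro nn_integral_mono mult_right_mono ray) simp
    also have "\<dots> = (\<integral>\<^sup>+\<theta>. ennreal B * indicator {0..2 * pi} \<theta> \<partial>lborel)
        + 2 * (\<integral>\<^sup>+\<theta>. \<integral>\<^sup>+s. ennreal s * (ennreal (?w (of_real s * cis \<theta>)) * indicator {0..2 * pi} \<theta>) \<partial>lborel \<partial>lborel)"
    proof -
      define J where "J \<theta> = (\<integral>\<^sup>+s. ennreal s * ennreal (?w (of_real s * cis \<theta>)) \<partial>lborel)" for \<theta>
      have [measurable]: "J \<in> borel_measurable borel"
        unfolding J_def[abs_def] by measurable
      have J: "J \<theta> * indicator {0..2 * pi} \<theta>
          = (\<integral>\<^sup>+s. ennreal s * (ennreal (?w (of_real s * cis \<theta>)) * indicator {0..2 * pi} \<theta>) \<partial>lborel)" for \<theta>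
        unfolding J_def mult.assoc[symmetric] by (rule nn_integral_multc[symmetric]) simp
      have "(\<integral>\<^sup>+\<theta>. (ennreal B + 2 * J \<theta>) * indicator {0..2 * pi} \<theta> \<partial>lborel)
          = (\<integral>\<^sup>+\<theta>. ennreal B * indicator {0..2 * pi} \<theta> + 2 * (J \<theta> * indicator {0..2 * pi} \<theta>) \<partial>lborel)"
        by (simp add: distrib_right mult.assoc)
      also have "\<dots> = (\<integral>\<^sup>+\<theta>. ennreal B * indicator {0..2 * pi} \<theta> \<partial>lborel)
          + (\<integral>\<^sup>+\<theta>. 2 * (J \<theta> * indicator {0..2 * pi} \<theta>) \<partial>lborel)"
        by (rule nn_integral_add) simp_all
      also have "(\<integral>\<^sup>+\<theta>. 2 * (J \<theta> * indicator {0..2 * pi} \<theta>) \<partial>lborel) = 2 * (\<integral>\<^sup>+\<theta>. J \<theta> * indicator {0..2 * pi} \<theta> \<partial>lborel)"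
        by (rule nn_integral_cmult) simp
      finally show ?thesis
        unfolding J[symmetric] unfolding J_def .
    qed
    also have "(\<integral>\<^sup>+\<theta>. ennreal B * indicator {0..2 * pi} \<theta> \<partial>lborel) = ennreal (2 * pi * B)"
      using B0 by (subst nn_integral_cmult_indicator) (auto simp: ennreal_mult mult_ac)
    also have "(\<integral>\<^sup>+\<theta>. \<integral>\<^sup>+s. ennreal s * (ennreal (?w (of_real s * cis \<theta>)) * indicator {0..2 * pi} \<theta>) \<partial>lborel \<partial>lborel)
        = (\<integral>\<^sup>+s. \<integral>\<^sup>+\<theta>. ennreal s * (ennreal (?w (of_real s * cis \<theta>)) * indicator {0..2 * pi} \<theta>) \<partial>lborel \<partial>lborel)"
      by (rule lborel_pair.Fubini'[symmetric]) simp
    also have "\<dots> = ennreal I"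
      by (simp add: nn_integral_cmult I_polar)
    also have "ennreal (2 * pi * B) + 2 * ennreal I = ennreal (2 * pi * B + 2 * I)"
      using B0 I0 by (simp add: ennreal_mult)
    finally show ?thesis
      using B0 I0 by (subst (asm) ennreal_le_iff) auto
  qed
  have "cmod (T_op (\<lambda>z. z) f z) \<le> 2 * pi * B + 2 * I"
    by (rule cmod_T_op_id_le_circle_means[OF hol, where s = "1 / 2"]) (use large z in auto)
  \<comment> \<open>\<open>1 / pi * I\<close> is the normalised area integral in
    \<open>dirichlet_norm\<close>; its coefficient \<open>4 * pi\<^sup>2 + 2 * pi\<close> also
    dominates that of \<open>cmod (f 0)\<close>.\<close>
  also have "\<dots> = 2 * pi * cmod (f 0) + (4 * pi\<^sup>2 + 2 * pi) * (1 / pi * I)"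
    by (simp add: B_def field_simps power2_eq_square)
  also have "\<dots> \<le> (4 * pi\<^sup>2 + 2 * pi) * cmod (f 0) + (4 * pi\<^sup>2 + 2 * pi) * (1 / pi * I)"
    by (intro add_right_mono mult_right_mono) auto
  also have "\<dots> = (4 * pi\<^sup>2 + 2 * pi) * dirichlet_norm 1 f"
    using I0 by (simp add: dirichlet_norm_eq I_def[symmetric] distrib_left)
  finally show ?thesis .
qed

section \<open>The three assertions for all three spaces\<close>

theorem theorem2:
  fixes X :: "real \<Rightarrow> (complex \<Rightarrow> complex) set"
    and N :: "real \<Rightarrow> (complex \<Rightarrow> complex) \<Rightarrow> real"
  assumes "(X, N) \<in> {(hardy_space, hardy_norm), (dirichlet_space, dirichlet_norm), (HL_space, HL_norm)}"
  shows "(\<forall>q :: complex poly. poly q \<in> T_bounded (X 1) (N 1))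
    \<and> (\<forall>p. 0 < p \<and> p < 1 \<longrightarrow> T_bounded (X p) (N p) = const_on_disc)
    \<and> T_compact (X 1) (N 1) = const_on_disc"
proof (intro conjI allI impI)
  consider "X = hardy_space" "N = hardy_norm" | "X = dirichlet_space" "N = dirichlet_norm" | "X = HL_space" "N = HL_norm"
    using assms by auto
  note spaces = this
  have test: "\<exists>C. \<forall>a\<in>\<bbbD>. test_fun p k a \<in> X p \<and> 0 \<le> N p (test_fun p k a) \<and> N p (test_fun p k a) \<le> C"
    if "0 < p" "p \<le> 1" "2 \<le> real k * p" for p k
    using spaces
  proof cases
    case 1
    then show ?thesis
      using test_fun_hardy[OF _ that(1,3)] by blast
  next
    case 2
    then show ?thesis
      using test_fun_dirichlet[OF _ that(1,3)] by blast
  next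
    case 3
    then show ?thesis
      using test_fun_HL[OF _ that] by blast
  qed
  have hol: "f holomorphic_on \<bbbD>" if "f \<in> X 1" for f
    using assms that by (auto simp: hardy_space_def dirichlet_space_def HL_space_def)
  have "\<exists>C. \<forall>f\<in>X 1. \<forall>z\<in>\<bbbD>. cmod (T_op (\<lambda>z. z) f z) \<le> C * N 1 f"
    using spaces
  proof cases
    case 1
    then show ?thesis
      using hardy_T_op_id by blast
  next
    case 2
    then show ?thesis
      using dirichlet_T_op_id by blast
  next
    case 3
    then show ?thesis
      using HL_T_op_id by (intro exI[of _ 1]) simp
  qed
  then show "poly q \<in> T_bounded (X 1) (N 1)" for q
    using poly_in_T_bounded[of "X 1"] hol by blast
  \<comment> \<open>For \<open>p = 1\<close> the exponent \<open>k = 2\<close> meets both demands,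
    \<open>2 \<le> k * p\<close> for the norm bounds and \<open>k > 1\<close> for pointwise
    decay.\<close>
  obtain C where C: "\<And>a. a \<in> \<bbbD> \<Longrightarrow> test_fun 1 2 a \<in> X 1 \<and> N 1 (test_fun 1 2 a) \<le> C"
    using test[of 1 2] by fastforce
  show "T_compact (X 1) (N 1) = const_on_disc"
    by (rule T_compact_eq_const_on_disc[where k = 2 and C = C]) (use C in simp_all)
  fix p :: real assume p: "0 < p \<and> p < 1"
  obtain k :: nat where "2 / p \<le> real k"
    using real_arch_simple by blast
  then have "2 \<le> real k * p"
    using p by (simp add: field_simps)
  then obtain C where C: "\<And>a. a \<in> \<bbbD> \<Longrightarrow> test_fun p k a \<in> X p \<and> 0 \<le> N p (test_fun p k a) \<and> N p (test_fun p k a) \<le> C"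
    using test[of p k] p by (metis less_imp_le)
  show "T_bounded (X p) (N p) = const_on_disc"
    by (rule T_bounded_eq_const_on_disc[where p = p and k = k and C = C]) (use p C in blast)+
qed

end
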